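(* There exist $\mathbf{z}_0:\mathbb{R}^3\to\mathbb{R}^3$ and $\mathbf{f}:\mathbb{R}_+\times\mathbb{R}^3\to\mathbb{R}^3$ such that for the solution $\mathbf{z}:\mathbb{R}_+\times\mathbb{R}^3\to\mathbb{R}^3$ of the Stokes system $$\partial_t \mathbf{z}-\Delta \mathbf{z}+\nabla Q=\mathbf{f},\qquad \operatorname{div}\mathbf{z}=0,\qquad \mathbf{z}(0)=\mathbf{z}_0\qquad\text{in }\mathbb{R}_+\times\mathbb{R}^3$$ the following properties hold: (i) $\mathbf{z}\in L^\infty(0,\infty;(L^2(\mathbb{R}^3))^3)\cap L^2(0,\infty;(H^1(\mathbb{R}^3))^3)$; (ii) $\mathbf{z}$ has compact support in $[0,\infty)\times\mathbb{R}^3$; (iii) $\mathbf{z}(t)\in C^\infty(\mathbb{R}^3)$ for all $t\ge0$; (iv) $\mathbf{z}$ satisfies $$\mathbf{z}\in L^\infty_{\mathrm{loc}}([0,\infty);L^2(\mathbb{R}^3))\cap L^2_{\mathrm{loc}}([0,\infty);H^1(\mathbb{R}^3)),$$ $$\mathbf{z}\in L^\infty_{\mathrm{loc}}([0,\infty);L^q_{\mathrm{loc}}(\mathbb{R}^3))\quad\text{for some }q>6,$$ $$\lim_{r\to0}\frac1r\iint_{Q_r(t,x)}|\nabla\mathbf{z}|^2\,ds\,dy=0\quad\text{for all }(t,x)\in(0,\infty)\times\mathbb{R}^3;$$ (v) $\mathcal{H}^1(S(\mathbf{z}))>0$.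
   Context: $Q_r(t,x)=\{(s,y)\mid t-r^2<s<t,\ |x-y|<r\}$. The force $\mathbf{f}$ is a locally integrable function and the Stokes system is understood in the sense of distributions (with initial condition $\mathbf{z}_0$). A space-time point $(t,x)$ is regular for a vector field $u$ if $u$ is essentially bounded in some neighbourhood of $(t,x)$; it is singular otherwise; $S(u)$ denotes the set of all singular points of $u$, a subset of space-time. $\mathcal{H}^1$ is the one-dimensional Hausdorff measure. *)

theory Defs
  imports "HOL-Analysis.Analysis"
begin

section \<open>Smooth functions, test functions, distributions\<close>

text \<open>Directional and iterated directional derivatives. They are only meaningful where the
  functions involved are differentiable, which smoothness guarantees.\<close>

definition dir_deriv :: "'a::euclidean_space \<Rightarrow> ('a \<Rightarrow> 'b::real_normed_vector) \<Rightarrow> 'a \<Rightarrow> 'b" where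
  "dir_deriv b \<phi> x = frechet_derivative \<phi> (at x) b"

primrec iter_deriv :: "'a::euclidean_space list \<Rightarrow> ('a \<Rightarrow> 'b::real_normed_vector) \<Rightarrow> 'a \<Rightarrow> 'b" where
  "iter_deriv [] \<phi> = \<phi>"
| "iter_deriv (b # bs) \<phi> = dir_deriv b (iter_deriv bs \<phi>)"

text \<open>\<open>C\<^sup>\<infinity>\<close>: partial derivatives of every order exist and are Frechet differentiable, hence
  also continuous.\<close>

definition smooth :: "('a::euclidean_space \<Rightarrow> 'b::real_normed_vector) \<Rightarrow> bool" where
  "smooth \<phi> \<longleftrightarrow> (\<forall>bs. set bs \<subseteq> Basis \<longrightarrow> (\<forall>x. iter_deriv bs \<phi> differentiable (at x)))"

definition supp :: "('a::topological_space \<Rightarrow> 'b::zero) \<Rightarrow> 'a set" where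
  "supp \<phi> = closure {x. \<phi> x \<noteq> 0}"

definition test_fun :: "'a::euclidean_space set \<Rightarrow> ('a \<Rightarrow> 'b::real_normed_vector) \<Rightarrow> bool" where
  "test_fun \<Omega> \<phi> \<longleftrightarrow> smooth \<phi> \<and> compact (supp \<phi>) \<and> supp \<phi> \<subseteq> \<Omega>"

text \<open>Real distributions on an open set \<open>\<Omega>\<close>: linear functionals on test functions that are
  continuous, i.e. on each compact set bounded by some \<open>C\<^sup>N\<close>-norm. Values of \<open>Q\<close> off the test
  functions are irrelevant.\<close>

definition is_distribution :: "'a::euclidean_space set \<Rightarrow> (('a \<Rightarrow> real) \<Rightarrow> real) \<Rightarrow> bool" where
  "is_distribution \<Omega> Q \<longleftrightarrow>
     (\<forall>\<phi> \<psi>. test_fun \<Omega> \<phi> \<longrightarrow> test_fun \<Omega> \<psi> \<longrightarrow> Q (\<lambda>x. \<phi> x + \<psi> x) = Q \<phi> + Q \<psi>) \<and>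
     (\<forall>c \<phi>. test_fun \<Omega> \<phi> \<longrightarrow> Q (\<lambda>x. c * \<phi> x) = c * Q \<phi>) \<and>
     (\<forall>K. compact K \<and> K \<subseteq> \<Omega> \<longrightarrow>
        (\<exists>N C. \<forall>\<phi> M. test_fun \<Omega> \<phi> \<longrightarrow> supp \<phi> \<subseteq> K \<longrightarrow>
           (\<forall>bs x. set bs \<subseteq> Basis \<longrightarrow> length bs \<le> N \<longrightarrow> \<bar>iter_deriv bs \<phi> x\<bar> \<le> M) \<longrightarrow>
           \<bar>Q \<phi>\<bar> \<le> C * M))"


section \<open>Function spaces\<close>

definition locally_integrable_on ::
  "('a::euclidean_space \<Rightarrow> 'b::euclidean_space) \<Rightarrow> 'a set \<Rightarrow> bool" (infix "locally'_integrable'_on" 50) where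
  "u locally_integrable_on S \<longleftrightarrow> (\<forall>K. compact K \<and> K \<subseteq> S \<longrightarrow> set_integrable lebesgue K u)"

definition in_Lp :: "real \<Rightarrow> 'a::euclidean_space set \<Rightarrow> ('a \<Rightarrow> 'b::euclidean_space) \<Rightarrow> bool" where
  "in_Lp p S u \<longleftrightarrow> u \<in> borel_measurable (lebesgue_on S) \<and>
     set_integrable lebesgue S (\<lambda>x. norm (u x) powr p)"

definition Lp_norm :: "real \<Rightarrow> 'a::euclidean_space set \<Rightarrow> ('a \<Rightarrow> 'b::euclidean_space) \<Rightarrow> real" where
  "Lp_norm p S u = (LINT x:S|lebesgue. norm (u x) powr p) powr (1 / p)"

text \<open>\<open>G x $ j $ i\<close> is the weak derivative of the \<open>j\<close>-th component in direction \<open>i\<close>. The norm of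
  \<open>real^3^3\<close> is the Frobenius norm, so \<open>norm (G x)^2\<close> is the sum of the squares of all entries.\<close>

definition has_weak_gradient :: "(real^3 \<Rightarrow> real^3) \<Rightarrow> (real^3 \<Rightarrow> real^3^3) \<Rightarrow> bool" where
  "has_weak_gradient u G \<longleftrightarrow>
     u locally_integrable_on UNIV \<and> G locally_integrable_on UNIV \<and>
     (\<forall>\<phi> i j. test_fun UNIV \<phi> \<longrightarrow>
        (LINT x|lebesgue. u x $ j * dir_deriv (axis i 1) \<phi> x) =
        - (LINT x|lebesgue. G x $ j $ i * \<phi> x))"

text \<open>\<open>G = \<nabla>z\<close> (derivatives in space only) for almost every time in \<open>I\<close>. This determines \<open>G\<close> up
  to a space-time null set.\<close>

definition has_spatial_gradient ::
  "real set \<Rightarrow> (real \<Rightarrow> real^3 \<Rightarrow> real^3) \<Rightarrow> (real \<Rightarrow> real^3 \<Rightarrow> real^3^3) \<Rightarrow> bool" where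
  "has_spatial_gradient I z G \<longleftrightarrow>
     (\<lambda>(t, x). G t x) \<in> borel_measurable (lebesgue_on (I \<times> UNIV)) \<and>
     (AE t in lebesgue. t \<in> I \<longrightarrow> has_weak_gradient (z t) (G t))"

text \<open>\<open>L\<^sup>\<infinity>(I; L\<^sup>p(S))\<close>\<close>

definition in_Linf_Lp :: "real set \<Rightarrow> real \<Rightarrow> (real^3) set \<Rightarrow> (real \<Rightarrow> real^3 \<Rightarrow> real^3) \<Rightarrow> bool" where
  "in_Linf_Lp I p S z \<longleftrightarrow>
     (\<lambda>(t, x). z t x) \<in> borel_measurable (lebesgue_on (I \<times> S)) \<and>
     (\<exists>C. AE t in lebesgue. t \<in> I \<longrightarrow> in_Lp p S (z t) \<and> Lp_norm p S (z t) \<le> C)"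

text \<open>\<open>L\<^sup>2(I; H\<^sup>1(\<real>\<^sup>3))\<close>: by Fubini the space-time integral below is the integral over \<open>I\<close> of the
  squared \<open>H\<^sup>1\<close>-norms of the functions \<open>z t\<close>.\<close>

definition in_L2_H1 :: "real set \<Rightarrow> (real \<Rightarrow> real^3 \<Rightarrow> real^3) \<Rightarrow> bool" where
  "in_L2_H1 I z \<longleftrightarrow>
     (\<lambda>(t, x). z t x) \<in> borel_measurable (lebesgue_on (I \<times> UNIV)) \<and>
     (\<exists>G. has_spatial_gradient I z G \<and>
        set_integrable lebesgue (I \<times> UNIV) (\<lambda>(t, x). (norm (z t x))\<^sup>2 + (norm (G t x))\<^sup>2))"


section \<open>The Stokes system\<close>

definition dt :: "(real \<times> (real^3) \<Rightarrow> 'b::real_normed_vector) \<Rightarrow> real \<times> (real^3) \<Rightarrow> 'b" where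
  "dt \<phi> = dir_deriv (1, 0) \<phi>"

definition dx :: "3 \<Rightarrow> (real \<times> (real^3) \<Rightarrow> 'b::real_normed_vector) \<Rightarrow> real \<times> (real^3) \<Rightarrow> 'b" where
  "dx i \<phi> = dir_deriv (0, axis i 1) \<phi>"

definition lapl :: "(real \<times> (real^3) \<Rightarrow> 'b::real_normed_vector) \<Rightarrow> real \<times> (real^3) \<Rightarrow> 'b" where
  "lapl \<phi> p = (\<Sum>i\<in>UNIV. dx i (dx i \<phi>) p)"

definition grad :: "(real \<times> (real^3) \<Rightarrow> real) \<Rightarrow> real \<times> (real^3) \<Rightarrow> real^3" where
  "grad \<psi> p = (\<chi> i. dx i \<psi> p)"

definition divg :: "(real \<times> (real^3) \<Rightarrow> real^3) \<Rightarrow> real \<times> (real^3) \<Rightarrow> real" where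
  "divg \<phi> p = (\<Sum>i\<in>UNIV. dx i \<phi> p $ i)"

text \<open>Both equations hold in the sense of distributions on \<open>(0,\<infinity>) \<times> \<real>\<^sup>3\<close>, the pressure \<open>Q\<close> being an
  arbitrary distribution there. The initial value is attained pointwise by \<open>z 0\<close> and as the limit
  of \<open>z t\<close> in the sense of distributions on \<open>\<real>\<^sup>3\<close> as \<open>t\<close> decreases to 0. Only values at times
  \<open>t \<ge> 0\<close> matter.\<close>

definition stokes_solution ::
  "(real^3 \<Rightarrow> real^3) \<Rightarrow> (real \<Rightarrow> real^3 \<Rightarrow> real^3) \<Rightarrow> (real \<Rightarrow> real^3 \<Rightarrow> real^3) \<Rightarrow> bool" where
  "stokes_solution z0 f z \<longleftrightarrow>
     (\<lambda>(t, x). f t x) locally_integrable_on ({0..} \<times> UNIV) \<and>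
     (\<lambda>(t, x). z t x) locally_integrable_on ({0..} \<times> UNIV) \<and>
     (\<exists>Q. is_distribution ({0<..} \<times> UNIV) Q \<and>
        (\<forall>\<phi>. test_fun ({0<..} \<times> UNIV) \<phi> \<longrightarrow>
           (LINT (t, x):{0<..} \<times> UNIV|lebesgue. z t x \<bullet> (- dt \<phi> (t, x) - lapl \<phi> (t, x)))
             - Q (divg \<phi>)
           = (LINT (t, x):{0<..} \<times> UNIV|lebesgue. f t x \<bullet> \<phi> (t, x)))) \<and>
     (\<forall>\<psi>. test_fun ({0<..} \<times> UNIV) \<psi> \<longrightarrow>
        (LINT (t, x):{0<..} \<times> UNIV|lebesgue. z t x \<bullet> grad \<psi> (t, x)) = 0) \<and>
     z 0 = z0 \<and>
     z0 locally_integrable_on UNIV \<and>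
     (\<forall>\<^sub>F t in at_right 0. z t locally_integrable_on UNIV) \<and>
     (\<forall>\<phi>. test_fun UNIV \<phi> \<longrightarrow>
        ((\<lambda>t. LINT x|lebesgue. z t x \<bullet> \<phi> x) \<longlongrightarrow> (LINT x|lebesgue. z0 x \<bullet> \<phi> x)) (at_right 0))"


section \<open>Singular points and Hausdorff measure\<close>

definition parabolic_cylinder :: "real \<Rightarrow> real \<Rightarrow> real^3 \<Rightarrow> (real \<times> (real^3)) set" where
  "parabolic_cylinder r t x = {t - r\<^sup>2 <..< t} \<times> ball x r"

definition regular_point :: "('a::euclidean_space) set \<Rightarrow> ('a \<Rightarrow> 'b::real_normed_vector) \<Rightarrow> 'a \<Rightarrow> bool" where
  "regular_point D u p \<longleftrightarrow>
     (\<exists>U C. open U \<and> p \<in> U \<and> (AE q in lebesgue. q \<in> U \<inter> D \<longrightarrow> norm (u q) \<le> C))"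

definition singular_set :: "('a::euclidean_space) set \<Rightarrow> ('a \<Rightarrow> 'b::real_normed_vector) \<Rightarrow> 'a set" where
  "singular_set D u = {p \<in> D. \<not> regular_point D u p}"

text \<open>One-dimensional Hausdorff (outer) measure; in dimension one the usual normalising constant
  is 1. The covering sets are required to be bounded because \<^const>\<open>diameter\<close> has no meaningful
  value on unbounded sets.\<close>

definition hausdorff1 :: "'a::metric_space set \<Rightarrow> ennreal" where
  "hausdorff1 A =
     (SUP \<delta>\<in>{0<..}.
        INF C\<in>{C :: nat \<Rightarrow> 'a set. A \<subseteq> (\<Union>i. C i) \<and> (\<forall>i. bounded (C i) \<and> diameter (C i) \<le> \<delta>)}.
          \<Sum>i. ennreal (diameter (C i)))"

end

(* Let s = 1 - t and z(t,x) = Psi((x - sin(1/s) e1) / s^3) / s for t < 1 and z = 0 for t >= 1, where Psi is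
   a smooth divergence-free field supported in the unit ball. The bump concentrates as t approaches 1 while
   its centre sweeps over the segment [-1,1] e1 infinitely often, and its amplitude 1/s blows up; hence all
   points of {1} x [-1,1] e1 are singular. Since the support has volume of order s^9, the spatial integrals of
   |z|^2, |z|^7 and |grad z|^2 (of size s^-8) are bounded uniformly in time, so that the scaled energy on a
   parabolic cylinder is O(r), and the force f = d_t z - Laplace z (of size s^-7) is integrable. The
   pressure is zero. *)

theory Submission
  imports Defs
begin

text \<open>Any divergence-free field solves the system with zero pressure if its heat residual is
  taken as the force. What has to be proved is that the residual is integrable and that the
  pointwise residual is also the distributional one across t = 1, where z is discontinuous. In space
  this is harmless, since each time slice is smooth with compact support. In time, almost every x
  lies off the axis carrying the centres, and for such x the field vanishes for all times near 1, so
  no jump term arises. The exponents: with radius s^p and amplitude s^-m, bounded slice integrals of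
  |z|^q and |grad z|^2 require 3p >= qm and p >= 2m. The choice p = 3, m = 1 allows all q up to 9.
  The centre sin(1/s) moves with speed at most s^-2, so its motion contributes s^-2 * s^-4 = s^-6 to
  the time derivative, and the Laplacian contributes s^-7; a ball of volume s^9 absorbs both. The
  sine takes each value a in [-1,1] at times accumulating at 1, so a single bump makes a whole
  segment singular.\<close>

section \<open>Smooth functions generated by the flat exponential, and directional
  derivatives\<close>

definition flat_exp :: "nat \<Rightarrow> real \<Rightarrow> real" where
  "flat_exp n u = (if u > 0 then exp (- 1 / u) / u ^ n else 0)"

text \<open>With v = 1/h the right difference quotient at 0 becomes v^(n+1) / exp v, which tends to
  0; the left one is identically 0.\<close>

lemma flat_exp_has_derivative_0: "(flat_exp n has_real_derivative 0) (at 0)"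
proof -
  have "((\<lambda>v::real. v ^ Suc n / exp v) \<longlongrightarrow> 0) at_top"
    by (rule tendsto_power_div_exp_0)
  then have "((\<lambda>h::real. (inverse h) ^ Suc n / exp (inverse h)) \<longlongrightarrow> 0) (at_right 0)"
    by (rule filterlim_compose[OF _ filterlim_inverse_at_top_right])
  then have r: "((\<lambda>h. flat_exp n h / h) \<longlongrightarrow> 0) (at_right 0)"
    by (rule Lim_transform_eventually)
      (auto simp: eventually_at_filter flat_exp_def field_simps exp_minus)
  have l: "((\<lambda>h. flat_exp n h / h) \<longlongrightarrow> 0) (at_left 0)"
    by (rule Lim_transform_eventually[OF tendsto_const])
      (auto simp: eventually_at_filter flat_exp_def)
  have "((\<lambda>h. flat_exp n h / h) \<longlongrightarrow> 0) (at 0)"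
    using r l filterlim_split_at by blast
  then show ?thesis
    by (simp add: DERIV_def flat_exp_def)
qed

text \<open>The derivative stays in the span of the family. This is the reason for carrying the
  powers of u in the denominator.\<close>

lemma flat_exp_has_real_derivative:
  "(flat_exp n has_real_derivative flat_exp (n + 2) u - n * flat_exp (n + 1) u) (at u)"
proof -
  consider "u < 0" | "u = 0" | "u > 0" by linarith
  then show ?thesis
  proof cases
    case 1
    have "((\<lambda>u. 0) has_real_derivative 0) (at u)" by simp
    then have "(flat_exp n has_real_derivative 0) (at u)"
      by (rule has_field_derivative_transform_within_open[of _ _ _ "{..<0}"])
        (use 1 in \<open>auto simp: flat_exp_def\<close>)
    then show ?thesis using 1 by (simp add: flat_exp_def)
  next
    case 2
    then show ?thesis using flat_exp_has_derivative_0[of n] by (simp add: flat_exp_def)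
  next
    case 3
    have "((\<lambda>u. exp (- 1 / u) / u ^ n) has_real_derivative flat_exp (n + 2) u - n * flat_exp (n + 1) u) (at u)"
      by (cases n; rule derivative_eq_intros refl | use 3 in \<open>simp add: flat_exp_def field_simps power2_eq_square\<close>)+
    then show ?thesis
      by (rule has_field_derivative_transform_within_open[of _ _ _ "{0<..}"])
        (use 3 in \<open>auto simp: flat_exp_def\<close>)
  qed
qed

text \<open>Every member of \<open>alg\<close> is differentiable with directional derivatives again in \<open>alg\<close>, so
  smoothness needs no induction on the order of differentiation for each function separately.\<close>

inductive alg :: "('a::euclidean_space \<Rightarrow> real) \<Rightarrow> bool" where
  const: "alg (\<lambda>x. c)"
| inner: "alg (\<lambda>x. x \<bullet> b)"
| add: "alg f \<Longrightarrow> alg g \<Longrightarrow> alg (\<lambda>x. f x + g x)"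
| mult: "alg f \<Longrightarrow> alg g \<Longrightarrow> alg (\<lambda>x. f x * g x)"
| flat_exp: "alg f \<Longrightarrow> alg (\<lambda>x. flat_exp n (f x))"

lemma dir_deriv_eq:
  assumes "(f has_derivative f') (at x)"
  shows "dir_deriv b f x = f' b"
  using frechet_derivative_at[OF assms] by (simp add: dir_deriv_def)

lemma dir_deriv_has_derivative:
  assumes "f differentiable (at x)"
  shows "(f has_derivative (\<lambda>h. dir_deriv h f x)) (at x)"
  using assms unfolding dir_deriv_def by (simp add: frechet_derivative_works)

lemma alg_diff: "alg f \<Longrightarrow> alg (\<lambda>x. f x - g x)" if "alg g"
  using alg.add[OF _ alg.mult[OF alg.const[of "-1"] that], of f] by simp

lemma alg_derivative:
  fixes f :: "'a::euclidean_space \<Rightarrow> real"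
  assumes "alg f"
  shows "(\<forall>x. f differentiable (at x)) \<and> alg (dir_deriv b f)"
  using assms
proof induction
  case (const c)
  have "dir_deriv b (\<lambda>x::'a. c) = (\<lambda>x. 0)"
    by (rule ext, rule dir_deriv_eq) (rule derivative_eq_intros refl)+
  then show ?case by (auto intro: alg.intros)
next
  case (inner c)
  have "dir_deriv b (\<lambda>x::'a. x \<bullet> c) = (\<lambda>x. b \<bullet> c)"
    by (rule ext, rule dir_deriv_eq) (rule derivative_eq_intros refl | simp)+
  then show ?case by (auto intro: alg.intros)
next
  case (add f g)
  have "dir_deriv b (\<lambda>x. f x + g x) = (\<lambda>x. dir_deriv b f x + dir_deriv b g x)"
    by (rule ext, rule dir_deriv_eq, rule has_derivative_add)
      (use add.IH dir_deriv_has_derivative in blast)+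
  then show ?case using add by (auto intro: alg.intros)
next
  case (mult f g)
  have "dir_deriv b (\<lambda>x. f x * g x) = (\<lambda>x. f x * dir_deriv b g x + dir_deriv b f x * g x)"
    by (rule ext, rule dir_deriv_eq, rule has_derivative_mult)
      (use mult.IH dir_deriv_has_derivative in blast)+
  then show ?case using mult by (auto intro: alg.intros)
next
  case (flat_exp f n)
  have d: "((\<lambda>x. flat_exp n (f x)) has_derivative
      (\<lambda>h. (flat_exp (n + 2) (f x) - n * flat_exp (n + 1) (f x)) * dir_deriv h f x)) (at x)" for x
    using has_derivative_compose[OF dir_deriv_has_derivative
        flat_exp_has_real_derivative[unfolded has_field_derivative_def]] flat_exp.IH by blast
  then have "dir_deriv b (\<lambda>x. flat_exp n (f x)) =
      (\<lambda>x. (flat_exp (n + 2) (f x) - n * flat_exp (n + 1) (f x)) * dir_deriv b f x)"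
    by (intro ext dir_deriv_eq)
  then show ?case using d flat_exp by (auto simp: differentiable_def intro!: alg.intros alg_diff)
qed

text \<open>Since the vectors are constant, differentiation only acts on the \<open>alg\<close>
  coefficients, so closure under \<open>dir_deriv\<close> is inherited.\<close>

inductive valg :: "('a::euclidean_space \<Rightarrow> 'b::real_normed_vector) \<Rightarrow> bool" where
  scale: "alg f \<Longrightarrow> valg (\<lambda>x. f x *\<^sub>R v)"
| add: "valg f \<Longrightarrow> valg g \<Longrightarrow> valg (\<lambda>x. f x + g x)"

lemma valg_derivative:
  assumes "valg f"
  shows "(\<forall>x. f differentiable (at x)) \<and> valg (dir_deriv b f)"
  using assms
proof induction
  case (scale f v)
  have d: "((\<lambda>x. f x *\<^sub>R v) has_derivative (\<lambda>h. dir_deriv h f x *\<^sub>R v)) (at x)" for x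
    using alg_derivative[OF scale] by (intro has_derivative_scaleR_left dir_deriv_has_derivative) blast
  then have "dir_deriv b (\<lambda>x. f x *\<^sub>R v) = (\<lambda>x. dir_deriv b f x *\<^sub>R v)"
    by (intro ext dir_deriv_eq)
  then show ?case using d alg_derivative[OF scale]
    by (auto simp: differentiable_def intro!: valg.intros)
next
  case (add f g)
  have "dir_deriv b (\<lambda>x. f x + g x) = (\<lambda>x. dir_deriv b f x + dir_deriv b g x)"
    by (rule ext, rule dir_deriv_eq, rule has_derivative_add)
      (use add.IH dir_deriv_has_derivative in blast)+
  then show ?case using add by (auto intro: valg.intros)
qed

lemma valg_smooth: "valg f \<Longrightarrow> smooth f"
proof -
  assume f: "valg f"
  have "valg (iter_deriv bs f)" for bs
    by (induction bs) (use f valg_derivative in auto)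
  then show ?thesis using valg_derivative unfolding smooth_def by blast
qed

lemma smooth_differentiable: "smooth f \<Longrightarrow> f differentiable (at x)"
  unfolding smooth_def by (metis empty_subsetI iter_deriv.simps(1) list.set(1))

lemma iter_deriv_append: "iter_deriv (bs @ cs) f = iter_deriv bs (iter_deriv cs f)"
  by (induction bs) auto

lemma smooth_dir_deriv:
  fixes f :: "'a::euclidean_space \<Rightarrow> 'b::real_normed_vector"
  assumes "smooth f" "b \<in> Basis"
  shows "smooth (dir_deriv b f)"
  unfolding smooth_def
proof (intro allI impI)
  fix bs :: "'a list" and x assume "set bs \<subseteq> Basis"
  then have "iter_deriv (bs @ [b]) f differentiable at x"
    using assms unfolding smooth_def by (metis Un_insert_right empty_subsetI insert_subset list.set(1,2) set_append sup_bot_right)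
  then show "iter_deriv bs (dir_deriv b f) differentiable at x"
    by (simp add: iter_deriv_append)
qed

lemma smooth_continuous_on: "smooth f \<Longrightarrow> continuous_on S f"
  by (meson continuous_at_imp_continuous_on differentiable_imp_continuous_within smooth_differentiable)

lemma dir_deriv_zero_outside:
  assumes "closed K" "\<And>x. x \<notin> K \<Longrightarrow> f x = 0" "x \<notin> K"
  shows "dir_deriv b f x = 0"
proof -
  have "((\<lambda>x. 0) has_derivative (\<lambda>h. 0)) (at x)" by simp
  then have "(f has_derivative (\<lambda>h. 0)) (at x)"
    by (rule has_derivative_transform_within_open[of _ _ _ _ "- K"]) (use assms in auto)
  then show ?thesis by (rule dir_deriv_eq)
qed

section \<open>Integration by parts\<close>

text \<open>Translation invariance makes the integrals of the difference quotients vanish.\<close>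

lemma integral_dir_deriv_eq_0:
  fixes F :: "'a::euclidean_space \<Rightarrow> real"
  assumes d: "\<And>x. F differentiable (at x)"
    and c: "continuous_on UNIV (dir_deriv b F)"
    and K: "compact K" "\<And>x. x \<notin> K \<Longrightarrow> F x = 0"
  shows "(LINT x|lborel. dir_deriv b F x) = 0"
proof -
  have cF: "continuous_on UNIV F"
    by (meson continuous_at_imp_continuous_on d differentiable_imp_continuous_within)
  have zero: "dir_deriv b F x = 0" if "x \<notin> K" for x
    using dir_deriv_zero_outside[OF compact_imp_closed[OF K(1)] K(2) that] .
  have "bounded (dir_deriv b F ` K)"
    by (intro compact_imp_bounded compact_continuous_image K continuous_on_subset[OF c]) auto
  then obtain M0 where M0: "\<And>x. x \<in> K \<Longrightarrow> \<bar>dir_deriv b F x\<bar> \<le> M0"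
    unfolding bounded_iff by auto
  \<comment> \<open>If K is empty, M0 may be negative; the maximum makes M a bound for the
    derivative everywhere.\<close>
  define M where "M = max M0 0"
  have M: "\<bar>dir_deriv b F x\<bar> \<le> M" for x
    using M0[of x] zero[of x] unfolding M_def by (cases "x \<in> K") auto
  have M_nonneg: "0 \<le> M" by (simp add: M_def)
  have vd: "((\<lambda>s. F (x + s *\<^sub>R b)) has_real_derivative dir_deriv b F (x + s *\<^sub>R b)) (at s)" for x s
  proof -
    have "((\<lambda>s. F (x + s *\<^sub>R b)) has_derivative (\<lambda>h. dir_deriv (h *\<^sub>R b) F (x + s *\<^sub>R b))) (at s)"
      by (rule has_derivative_compose[OF _ dir_deriv_has_derivative[OF d], of "\<lambda>s. x + s *\<^sub>R b" "\<lambda>h. h *\<^sub>R b"])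
        (auto intro!: derivative_eq_intros)
    moreover have "dir_deriv (h *\<^sub>R b) F y = h * dir_deriv b F y" for h y
      using linear_scale[OF has_derivative_linear[OF dir_deriv_has_derivative[OF d]], of h b y] by simp
    ultimately show ?thesis
      by (simp add: has_field_derivative_def mult_commute_abs)
  qed
  define h where "h n = inverse (real (Suc n))" for n
  have h: "0 < h n" "h n \<le> 1" for n by (auto simp: h_def field_simps)
  have h0: "h \<longlonglongrightarrow> 0" unfolding h_def by (rule LIMSEQ_inverse_real_of_nat)
  define q where "q n x = (F (x + h n *\<^sub>R b) - F x) / h n" for n x
  obtain R where R: "\<forall>x\<in>K. norm x \<le> R"
    using compact_imp_bounded[OF K(1)] unfolding bounded_iff by blast
  \<comment> \<open>Since h n <= 1, a point outside B has neither itself nor its translate by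
    \<open>h n *\<^sub>R b\<close> in K. Hence all difference quotients live on B, and
    \<open>M * indicator B\<close> dominates them.\<close>
  define B where "B = cball (0::'a) (R + norm b)"
  have qM: "\<bar>q n x\<bar> \<le> M * indicator B x" for n x
  proof (cases "x \<in> B")
    case True
    obtain s where "s > 0" "s < h n" "F (x + h n *\<^sub>R b) - F (x + 0 *\<^sub>R b) = (h n - 0) * dir_deriv b F (x + s *\<^sub>R b)"
      using MVT2[of 0 "h n" "\<lambda>s. F (x + s *\<^sub>R b)" "\<lambda>s. dir_deriv b F (x + s *\<^sub>R b)"] vd h(1)[of n] by blast
    then have "q n x = dir_deriv b F (x + s *\<^sub>R b)" using h(1)[of n] by (simp add: q_def field_simps)
    then show ?thesis using M True by simp
  next
    case False
    have "x \<notin> K" using False R norm_ge_zero[of b] unfolding B_def mem_cball_0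
      by (metis add_increasing2)
    moreover have "x + h n *\<^sub>R b \<notin> K"
    proof
      assume "x + h n *\<^sub>R b \<in> K"
      then have "norm (x + h n *\<^sub>R b) \<le> R" using R by blast
      moreover have "norm (h n *\<^sub>R b) \<le> norm b"
        using h[of n] by (simp add: mult_left_le_one_le)
      ultimately have "norm x \<le> R + norm b"
        using norm_triangle_ineq4[of "x + h n *\<^sub>R b" "h n *\<^sub>R b"] by simp
      then show False using False by (simp add: B_def)
    qed
    ultimately show ?thesis using K(2) M_nonneg by (simp add: q_def)
  qed
  have lim: "(\<lambda>n. q n x) \<longlonglongrightarrow> dir_deriv b F x" for x
  proof -
    have "((\<lambda>s. (F (x + s *\<^sub>R b) - F x) / s) \<longlongrightarrow> dir_deriv b F x) (at 0)"
      using vd[of x 0] by (simp add: DERIV_def)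
    moreover have "filterlim h (at 0) sequentially"
      using h0 h(1) by (simp add: filterlim_at less_imp_neq[THEN not_sym])
    ultimately show ?thesis unfolding q_def by (rule filterlim_compose)
  qed
  have meas: "F \<in> borel_measurable borel" by (rule borel_measurable_continuous_onI[OF cF])
  have intF: "integrable lborel F"
  proof -
    have "integrable lborel (\<lambda>x. indicator K x *\<^sub>R F x)"
      by (rule borel_integrable_compact[OF K(1) continuous_on_subset[OF cF]]) simp
    moreover have "(\<lambda>x. indicator K x *\<^sub>R F x) = F"
      by (auto simp: fun_eq_iff indicator_def K(2))
    ultimately show ?thesis by simp
  qed
  have sh: "integrable lborel (\<lambda>x. F (x + a))" "(LINT x|lborel. F (x + a)) = (LINT x|lborel. F x)" for a
  proof -
    have "(+) a = (\<lambda>x. x + a)" by (simp add: fun_eq_iff add.commute)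
    then have e: "lborel = distr lborel borel (\<lambda>x. x + a)"
      using lborel_distr_plus[of a] by simp
    have "integrable (distr lborel borel (\<lambda>x. x + a)) F" using intF e by metis
    then show "integrable lborel (\<lambda>x. F (x + a))"
      by (subst (asm) integrable_distr_eq) (use meas in auto)
    have "(LINT x|lborel. F x) = (LINT x|distr lborel borel (\<lambda>x. x + a). F x)" using e by metis
    also have "\<dots> = (LINT x|lborel. F (x + a))"
      by (rule integral_distr) (use meas in auto)
    finally show "(LINT x|lborel. F (x + a)) = (LINT x|lborel. F x)" by simp
  qed
  have q0: "(LINT x|lborel. q n x) = 0" for n
    unfolding q_def using sh intF by simp
  have "(\<lambda>n. LINT x|lborel. q n x) \<longlonglongrightarrow> (LINT x|lborel. dir_deriv b F x)"
  proof (rule integral_dominated_convergence[where w = "\<lambda>x. M * indicator B x"])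
    show "dir_deriv b F \<in> borel_measurable lborel"
      using borel_measurable_continuous_onI[OF c] by simp
    show "q n \<in> borel_measurable lborel" for n
      unfolding q_def using meas by measurable
    show "integrable lborel (\<lambda>x. M * indicator B x)"
      unfolding B_def by (intro integrable_mult_right integrable_real_indicator) (use emeasure_lborel_cball_finite[of "0::'a" "R + norm b"] in simp_all)
  qed (use lim qM in auto)
  then show ?thesis using q0 by (simp add: LIMSEQ_const_iff)
qed

section \<open>The rescaled moving profile\<close>

definition profile_coord :: "real \<Rightarrow> real^3 \<Rightarrow> real^3" where
  "profile_coord t x = (1 / (1 - t)) ^ 3 *\<^sub>R (x - sin (1 / (1 - t)) *\<^sub>R axis 1 1)"

text \<open>One family for all k: a space derivative raises k by 3
  (\<open>scaled_has_derivative\<close>), and the n-th power of the norm multiplies k by n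
  (\<open>norm_scaled_power\<close>). The solution has k = 1, its gradient k = 4, its Laplacian k =
  7.\<close>

definition scaled :: "nat \<Rightarrow> (real^3 \<Rightarrow> 'b::real_normed_vector) \<Rightarrow> real \<Rightarrow> real^3 \<Rightarrow> 'b" where
  "scaled k g t x = (if t < 1 then (1 / (1 - t)) ^ k *\<^sub>R g (profile_coord t x) else 0)"

text \<open>Since \<open>9 = 3 * 3\<close>, all time slices of \<open>weight\<close> have the same integral. This is why the powers
  of \<open>1 / (1 - t)\<close> up to 9 are integrable in space-time, which covers all terms of the force.\<close>

definition weight :: "real \<Rightarrow> real^3 \<Rightarrow> real" where
  "weight t x = (if 0 \<le> t \<and> t < 1 then
     (1 / (1 - t)) ^ 9 * indicator (cball (sin (1 / (1 - t)) *\<^sub>R axis 1 1) ((1 - t) ^ 3)) x else 0)"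

definition bump :: "(real^3 \<Rightarrow> 'b::real_normed_vector) \<Rightarrow> bool" where
  "bump g \<longleftrightarrow> continuous_on UNIV g \<and> (\<forall>y. norm y > 1 \<longrightarrow> g y = 0)"

lemma norm_profile_coord_gt_1_iff:
  assumes "t < 1"
  shows "norm (profile_coord t x) > 1 \<longleftrightarrow>
    x \<notin> cball (sin (1 / (1 - t)) *\<^sub>R axis 1 1) ((1 - t) ^ 3)"
proof -
  have "(1 - t) ^ 3 > 0" using assms by simp
  moreover have "norm (profile_coord t x) = norm (x - sin (1 / (1 - t)) *\<^sub>R axis 1 1) / (1 - t) ^ 3"
    using assms unfolding profile_coord_def norm_scaleR by (simp add: power_one_over)
  ultimately show ?thesis
    by (simp add: dist_norm norm_minus_commute[of x] not_le)
qed

lemma bump_bound: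
  assumes "bump g"
  obtains C where "C > 0" "\<And>y. norm (g y) \<le> C"
proof -
  have "bounded (g ` cball 0 1)"
    using assms unfolding bump_def
    by (intro compact_imp_bounded compact_continuous_image) (auto intro: continuous_on_subset)
  then obtain C where C: "\<forall>y\<in>cball 0 1. norm (g y) \<le> C"
    unfolding bounded_iff by blast
  have "norm (g y) \<le> max C 1" for y
  proof (cases "norm y \<le> 1")
    case True
    then show ?thesis using C by (simp add: le_max_iff_disj)
  next
    case False
    then show ?thesis using assms by (simp add: bump_def)
  qed
  then show thesis by (intro that[of "max C 1"]) auto
qed

lemma scaled_zero:
  assumes "bump g" "x \<notin> cball (sin (1 / (1 - t)) *\<^sub>R axis 1 1) ((1 - t) ^ 3)"
  shows "scaled k g t x = 0"
  using assms norm_profile_coord_gt_1_iff[of t x] by (auto simp: scaled_def bump_def)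

text \<open>For 0 <= t < 1 the base 1 / (1 - t) is at least 1, so its ninth power dominates all
  lower ones.\<close>

lemma scaled_le_weight:
  assumes g: "bump g" and C: "\<And>y. norm (g y) \<le> C" and t: "t \<ge> 0" and k: "k \<le> 9"
  shows "norm (scaled k g t x) \<le> C * weight t x"
proof (cases "t < 1 \<and> x \<in> cball (sin (1 / (1 - t)) *\<^sub>R axis 1 1) ((1 - t) ^ 3)")
  case True
  have "(1 / (1 - t)) ^ k \<le> (1 / (1 - t)) ^ 9"
    by (rule power_increasing) (use True t k in \<open>auto simp: field_simps\<close>)
  then have "(1 / (1 - t)) ^ k * norm (g (profile_coord t x)) \<le> (1 / (1 - t)) ^ 9 * C"
    using True by (intro mult_mono C) auto
  then show ?thesis using True t by (simp add: scaled_def weight_def mult.commute)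
next
  case False
  then have "scaled k g t x = 0"
    using scaled_zero[OF g, of x t k] by (cases "t < 1") (simp_all add: scaled_def)
  moreover have "0 \<le> C" using C norm_ge_zero order_trans by blast
  ultimately show ?thesis by (simp add: weight_def)
qed

lemma fst_borel_measurable [measurable]:
  "(fst :: 'a::second_countable_topology \<times> 'b::second_countable_topology \<Rightarrow> 'a) \<in> borel \<rightarrow>\<^sub>M borel"
  by (simp add: borel_prod[symmetric])

lemma snd_borel_measurable [measurable]:
  "(snd :: 'a::second_countable_topology \<times> 'b::second_countable_topology \<Rightarrow> 'b) \<in> borel \<rightarrow>\<^sub>M borel"
  by (simp add: borel_prod[symmetric])

lemma profile_coord_measurable [measurable]:
  "(\<lambda>p::real\<times>(real^3). profile_coord (fst p) (snd p)) \<in> borel_measurable borel"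
  unfolding profile_coord_def by measurable

lemma scaled_measurable:
  fixes g :: "real^3 \<Rightarrow> 'b::euclidean_space"
  assumes "continuous_on UNIV g"
  shows "(\<lambda>p. scaled k g (fst p) (snd p)) \<in> borel_measurable borel"
proof -
  have [measurable]: "g \<in> borel_measurable borel"
    using assms by (rule borel_measurable_continuous_onI)
  show ?thesis unfolding scaled_def by measurable
qed

lemma weight_measurable: "(\<lambda>p. weight (fst p) (snd p)) \<in> borel_measurable borel"
proof -
  have eq: "weight t x = (if 0 \<le> t \<and> t < 1 \<and> dist (sin (1 / (1 - t)) *\<^sub>R axis 1 1) x \<le> (1 - t) ^ 3
      then (1 / (1 - t)) ^ 9 else 0)" for t x
    by (auto simp: weight_def)
  show ?thesis unfolding eq by measurable
qed

lemma nn_integral_weight: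
  "(\<integral>\<^sup>+x. ennreal (weight t x) \<partial>lborel) = (if 0 \<le> t \<and> t < 1 then ennreal (unit_ball_vol 3) else 0)"
proof (cases "0 \<le> t \<and> t < 1")
  case True
  let ?B = "cball (sin (1 / (1 - t)) *\<^sub>R axis 1 1) ((1 - t) ^ 3) :: (real^3) set"
  have "(\<integral>\<^sup>+x. ennreal (weight t x) \<partial>lborel) =
      (\<integral>\<^sup>+x. ennreal ((1 / (1 - t)) ^ 9) * indicator ?B x \<partial>lborel)"
    using True by (intro nn_integral_cong) (auto simp: weight_def indicator_def)
  also have "\<dots> = ennreal ((1 / (1 - t)) ^ 9) * emeasure lborel ?B"
    by (simp add: nn_integral_cmult_indicator)
  also have "emeasure lborel ?B = ennreal (unit_ball_vol 3 * ((1 - t) ^ 3) ^ 3)"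
    using True emeasure_cball[of "(1 - t) ^ 3" "sin (1 / (1 - t)) *\<^sub>R axis 1 1 :: real^3"] by simp
  also have "ennreal ((1 / (1 - t)) ^ 9) * ennreal (unit_ball_vol 3 * ((1 - t) ^ 3) ^ 3) = ennreal (unit_ball_vol 3)"
    using True by (simp add: ennreal_mult[symmetric] power_mult[symmetric] power_one_over field_simps)
  finally show ?thesis using True by simp
next
  case False
  then have "weight t x = 0" for x unfolding weight_def by (rule if_not_P)
  moreover have "(if 0 \<le> t \<and> t < 1 then ennreal (unit_ball_vol 3) else 0) = 0"
    using False by (rule if_not_P)
  ultimately show ?thesis by simp
qed

lemma weight_nonneg: "0 \<le> weight t x"
  by (simp add: weight_def)

lemma integrable_weight: "integrable lborel (\<lambda>p. weight (fst p) (snd p))"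
proof (rule integrableI_bounded)
  show "(\<lambda>p. weight (fst p) (snd p)) \<in> borel_measurable lborel"
    using weight_measurable by simp
  have "(\<integral>\<^sup>+p. ennreal (norm (weight (fst p) (snd p))) \<partial>lborel) =
      (\<integral>\<^sup>+p. ennreal (weight (fst p) (snd p)) \<partial>(lborel \<Otimes>\<^sub>M lborel))"
    by (simp add: weight_nonneg lborel_prod)
  also have "\<dots> = (\<integral>\<^sup>+t. \<integral>\<^sup>+x. ennreal (weight t x) \<partial>lborel \<partial>lborel)"
  proof -
    have "(\<lambda>p. weight (fst p) (snd p)) \<in> borel_measurable (lborel \<Otimes>\<^sub>M lborel)"
      using weight_measurable by (simp add: lborel_prod)
    then show ?thesis
      by (subst lborel.nn_integral_fst[symmetric]) auto
  qed
  also have "\<dots> = (\<integral>\<^sup>+t. ennreal (unit_ball_vol 3) * indicator {0..<1::real} t \<partial>lborel)"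
    unfolding nn_integral_weight by (intro nn_integral_cong) (auto simp: indicator_def)
  also have "\<dots> < \<infinity>"
    by (simp add: nn_integral_cmult_indicator)
  finally show "(\<integral>\<^sup>+p. ennreal (norm (weight (fst p) (snd p))) \<partial>lborel) < \<infinity>" .
qed

lemma integrable_scaled:
  fixes g :: "real^3 \<Rightarrow> 'b::euclidean_space"
  assumes "bump g" "k \<le> 9"
  shows "integrable lborel (\<lambda>p. indicator {0..} (fst p) *\<^sub>R scaled k g (fst p) (snd p))"
proof -
  obtain C where C: "C > 0" "\<And>y. norm (g y) \<le> C" using bump_bound[OF assms(1)] by blast
  have [measurable]: "(\<lambda>p. scaled k g (fst p) (snd p)) \<in> borel_measurable borel"
    by (rule scaled_measurable) (use assms(1) in \<open>auto simp: bump_def\<close>)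
  have "(\<lambda>p. indicator {0..} (fst p) *\<^sub>R scaled k g (fst p) (snd p)) \<in> borel_measurable borel"
    by measurable
  then show ?thesis
  proof (intro Bochner_Integration.integrable_bound[OF integrable_mult_right[OF integrable_weight, of C]] AE_I2)
    show "norm (indicator {0..} (fst p) *\<^sub>R scaled k g (fst p) (snd p)) \<le>
        norm (C * weight (fst p) (snd p))" for p
      using scaled_le_weight[OF assms(1) C(2) _ assms(2), of "fst p" "snd p"] C(1)
      by (cases "fst p \<ge> 0") (auto simp: weight_nonneg)
  qed simp
qed

text \<open>The second factor is only bounded and measurable, so that an oscillating factor such as
  cos(1 / (1 - t)) can be absorbed into it. Its vanishing for times up to 0 removes the negative
  times, at which \<open>weight\<close> gives no control.\<close>

lemma integrable_scaled_inner:
  fixes g \<phi> :: "_ \<Rightarrow> 'b::euclidean_space"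
  assumes "bump g" "k \<le> 9" "\<phi> \<in> borel_measurable borel" "\<And>p. norm (\<phi> p) \<le> M" "\<And>p. fst p \<le> 0 \<Longrightarrow> \<phi> p = 0"
  shows "integrable lborel (\<lambda>p. scaled k g (fst p) (snd p) \<bullet> \<phi> p)"
proof (rule Bochner_Integration.integrable_bound)
  show "integrable lborel (\<lambda>p. M * norm (indicator {0..} (fst p) *\<^sub>R scaled k g (fst p) (snd p)))"
    by (intro integrable_mult_right integrable_norm integrable_scaled assms)
  note assms(3)[measurable]
  have [measurable]: "(\<lambda>p. scaled k g (fst p) (snd p)) \<in> borel_measurable borel"
    by (rule scaled_measurable) (use assms(1) in \<open>auto simp: bump_def\<close>)
  show "(\<lambda>p. scaled k g (fst p) (snd p) \<bullet> \<phi> p) \<in> borel_measurable lborel"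
    by measurable
  have "\<bar>scaled k g (fst p) (snd p) \<bullet> \<phi> p\<bar> \<le> M * norm (indicator {0..} (fst p) *\<^sub>R scaled k g (fst p) (snd p))" for p
  proof (cases "fst p \<ge> 0")
    case True
    have "\<bar>scaled k g (fst p) (snd p) \<bullet> \<phi> p\<bar> \<le> norm (scaled k g (fst p) (snd p)) * norm (\<phi> p)"
      by (rule Cauchy_Schwarz_ineq2)
    also have "\<dots> \<le> norm (scaled k g (fst p) (snd p)) * M"
      by (intro mult_left_mono assms) auto
    finally show ?thesis using True by (simp add: mult.commute)
  next
    case False
    then show ?thesis using assms(5)[of p] by simp
  qed
  then show "AE p in lborel. norm (scaled k g (fst p) (snd p) \<bullet> \<phi> p) \<le>
      norm (M * norm (indicator {0..} (fst p) *\<^sub>R scaled k g (fst p) (snd p)))"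
    by (intro AE_I2) (smt (verit) real_norm_def)
qed

section \<open>Continuity and derivatives of the moving field\<close>

lemma scaled_isCont:
  assumes "continuous_on UNIV g" "fst p < 1"
  shows "isCont (\<lambda>p. scaled k g (fst p) (snd p)) p"
proof -
  have y: "isCont (\<lambda>p. profile_coord (fst p) (snd p)) p"
    unfolding profile_coord_def using assms(2) by (intro continuous_intros) auto
  have "isCont g y" for y using assms(1) continuous_on_eq_continuous_at by blast
  then have "isCont (\<lambda>p. g (profile_coord (fst p) (snd p))) p"
    using isCont_o2[OF y] by blast
  then have c: "isCont (\<lambda>p. (1 / (1 - fst p)) ^ k *\<^sub>R g (profile_coord (fst p) (snd p))) p"
    using assms(2) by (intro continuous_intros) auto
  have "open {q::real\<times>(real^3). fst q < 1}"
    by (intro open_Collect_less continuous_intros)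
  then have "\<forall>\<^sub>F q in nhds p. fst q < 1"
    using assms(2) by (auto simp: eventually_nhds)
  then have "\<forall>\<^sub>F q in nhds p. scaled k g (fst q) (snd q) = (1 / (1 - fst q)) ^ k *\<^sub>R g (profile_coord (fst q) (snd q))"
    by (rule eventually_mono) (simp add: scaled_def)
  note eq = isCont_cong[OF this]
  show ?thesis unfolding eq by (rule c)
qed

text \<open>The chain rule through the affine map \<open>profile_coord t\<close> contributes the
  factor (1 / (1 - t))^3, hence the shift to k + 3. For t >= 1 both sides vanish, so the formula is
  valid at all times.\<close>

lemma scaled_has_derivative:
  assumes "\<And>y. g differentiable (at y)"
  shows "(scaled k g t has_derivative (\<lambda>h. scaled (k + 3) (dir_deriv h g) t x)) (at x)"
proof (cases "t < 1")
  case True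
  have y: "(profile_coord t has_derivative (\<lambda>h. (1 / (1 - t)) ^ 3 *\<^sub>R h)) (at x)"
    unfolding profile_coord_def by (rule derivative_eq_intros refl | simp)+
  have lin: "dir_deriv (c *\<^sub>R h) g y = c *\<^sub>R dir_deriv h g y" for c h y
    using linear_scale[OF has_derivative_linear[OF dir_deriv_has_derivative[OF assms]]] .
  have "((\<lambda>x. (1 / (1 - t)) ^ k *\<^sub>R g (profile_coord t x)) has_derivative
      (\<lambda>h. (1 / (1 - t)) ^ k *\<^sub>R dir_deriv ((1 / (1 - t)) ^ 3 *\<^sub>R h) g (profile_coord t x))) (at x)"
    by (intro has_derivative_scaleR_right has_derivative_compose[OF y dir_deriv_has_derivative[OF assms]])
  then show ?thesis using True unfolding scaled_def lin by (simp add: power_add)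
qed (simp add: scaled_def[abs_def])

text \<open>The time derivative of \<^term>\<open>scaled 1 g\<close>; the last term comes from the oscillation of the
  centre, the other one from the change of scale.\<close>

definition scaled_dt :: "(real^3 \<Rightarrow> 'b::real_normed_vector) \<Rightarrow> real \<Rightarrow> real^3 \<Rightarrow> 'b" where
  "scaled_dt g t x = scaled 2 (\<lambda>y. g y + 3 *\<^sub>R dir_deriv y g y) t x -
     cos (1 / (1 - t)) *\<^sub>R scaled 6 (dir_deriv (axis 1 1) g) t x"

text \<open>The regrouping for the time derivative: r stands for 1 / (1 - t), a for cos r, w for the
  profile, u for its derivative in the direction y and v for its derivative along the first axis,
  all at the rescaled point.\<close>

lemma scaled_dt_identity:
  fixes u v w :: "'b::real_normed_vector"
  shows "r *\<^sub>R ((3 * r) *\<^sub>R u + (- (r ^ 5 * a)) *\<^sub>R v) + r ^ 2 *\<^sub>R w =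
    r ^ 2 *\<^sub>R (w + 3 *\<^sub>R u) - a *\<^sub>R r ^ 6 *\<^sub>R v"
proof -
  have 1: "r * (3 * r) = r ^ 2 * 3"
    by (simp add: power2_eq_square)
  have 2: "r * (r ^ 5 * a) = a * r ^ 6"
    by (simp add: eval_nat_numeral)
  show ?thesis
    unfolding scaleR_add_right scaleR_minus_right scaleR_minus_left scaleR_scaleR 1 2 by simp
qed

lemma scaled_has_vector_derivative:
  assumes g: "\<And>y. g differentiable (at y)" and t: "t < 1"
  shows "((\<lambda>t. scaled 1 g t x) has_vector_derivative scaled_dt g t x) (at t)"
proof -
  let ?s = "1 / (1 - t)"
  let ?y = "profile_coord t x"
  have lin: "dir_deriv (a *\<^sub>R h + b *\<^sub>R k) g y = a *\<^sub>R dir_deriv h g y + b *\<^sub>R dir_deriv k g y" for a b h k y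
  proof -
    have l: "linear (\<lambda>h. dir_deriv h g y)"
      by (rule has_derivative_linear[OF dir_deriv_has_derivative[OF g]])
    show ?thesis
      using linear_add[OF l, of "a *\<^sub>R h" "b *\<^sub>R k"] linear_scale[OF l, of a h] linear_scale[OF l, of b k] by simp
  qed
  have s: "((\<lambda>t. 1 / (1 - t)) has_real_derivative ?s ^ 2) (at t)"
    using t by (auto intro!: derivative_eq_intros simp: power2_eq_square)
  have c: "((\<lambda>t. x - sin (1 / (1 - t)) *\<^sub>R axis 1 1) has_vector_derivative
      0 - (cos ?s * ?s ^ 2) *\<^sub>R axis 1 1) (at t)"
  proof -
    have "((\<lambda>t. sin (1 / (1 - t))) has_real_derivative cos ?s * ?s ^ 2) (at t)"
      by (rule DERIV_fun_sin[OF s])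
    then show ?thesis
      using has_vector_derivative_diff[OF has_vector_derivative_const has_vector_derivative_scaleR[OF _ has_vector_derivative_const]]
      by fastforce
  qed
  have s3: "((\<lambda>t. (1 / (1 - t)) ^ 3) has_real_derivative 3 * ?s ^ 4) (at t)"
    using DERIV_power[OF s, of 3] by (simp add: power_add[symmetric] power_one_over)
  \<comment> \<open>With r = 1 / (1 - t), so r' = r^2, the factor r^3 contributes 3 r^4 (x - centre)
    = 3 r y, and the moving centre contributes - r^3 * r^2 cos r along the first axis.\<close>
  have y: "((\<lambda>t. profile_coord t x) has_vector_derivative (3 * ?s) *\<^sub>R ?y + (- (?s ^ 5 * cos ?s)) *\<^sub>R axis 1 1) (at t)"
  proof -
    have e: "r ^ 3 *\<^sub>R (0 - (a * r ^ 2) *\<^sub>R w) + (3 * r ^ 4) *\<^sub>R v =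
        (3 * r) *\<^sub>R (r ^ 3 *\<^sub>R v) + (- (r ^ 5 * a)) *\<^sub>R w" for r a and v w :: "real^3"
    proof -
      have *: "r ^ 3 * (a * r ^ 2) = r ^ 5 * a" "3 * r * r ^ 3 = 3 * r ^ 4"
        by (simp_all add: eval_nat_numeral)
      show ?thesis
        unfolding diff_0 scaleR_minus_right scaleR_minus_left scaleR_scaleR * by (rule add.commute)
    qed
    show ?thesis
      using has_vector_derivative_scaleR[OF s3 c] unfolding profile_coord_def e .
  qed
  have gy: "((\<lambda>t. g (profile_coord t x)) has_vector_derivative
      (3 * ?s) *\<^sub>R dir_deriv ?y g ?y + (- (?s ^ 5 * cos ?s)) *\<^sub>R dir_deriv (axis 1 1) g ?y) (at t)"
  proof -
    have *: "((\<lambda>t. g (profile_coord t x)) has_derivative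
        (\<lambda>h. dir_deriv (h *\<^sub>R ((3 * ?s) *\<^sub>R ?y + (- (?s ^ 5 * cos ?s)) *\<^sub>R axis 1 1)) g ?y)) (at t)"
      by (rule has_derivative_compose[OF y[unfolded has_vector_derivative_def] dir_deriv_has_derivative[OF g]])
    have **: "dir_deriv (h *\<^sub>R k) g ?y = h *\<^sub>R dir_deriv k g ?y" for h k
      using lin[of h k 0 k ?y] by simp
    show ?thesis
      using * unfolding has_vector_derivative_def ** lin .
  qed
  have d: "((\<lambda>t. (1 / (1 - t)) *\<^sub>R g (profile_coord t x)) has_vector_derivative
      ?s *\<^sub>R ((3 * ?s) *\<^sub>R dir_deriv ?y g ?y + (- (?s ^ 5 * cos ?s)) *\<^sub>R dir_deriv (axis 1 1) g ?y) +
      ?s ^ 2 *\<^sub>R g ?y) (at t)"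
    by (rule has_vector_derivative_scaleR[OF s gy])
  have eq: "scaled_dt g t x =
      ?s ^ 2 *\<^sub>R (g ?y + 3 *\<^sub>R dir_deriv ?y g ?y) - cos ?s *\<^sub>R ?s ^ 6 *\<^sub>R dir_deriv (axis 1 1) g ?y"
    unfolding scaled_dt_def scaled_def if_P[OF t] ..
  have "((\<lambda>t. (1 / (1 - t)) *\<^sub>R g (profile_coord t x)) has_vector_derivative scaled_dt g t x) (at t)"
    using d unfolding eq scaled_dt_identity .
  then show ?thesis
  proof (rule has_vector_derivative_transform_within_open)
    show "open {..<1::real}" "t \<in> {..<1}" using t by simp_all
    show "(1 / (1 - r)) *\<^sub>R g (profile_coord r x) = scaled 1 g r x" if "r \<in> {..<1}" for r
      using that unfolding scaled_def by simp
  qed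
qed

text \<open>All centres lie on the first axis, so x has distance at least |x $ 2| from each of them.
  Once the radius (1 - s)^3 drops below this, the bump no longer reaches x; from time 1 on the field
  is zero anyway.\<close>

lemma scaled_locally_zero:
  assumes "bump g" "x $ 2 \<noteq> 0" "t \<ge> 1"
  shows "\<forall>\<^sub>F s in nhds t. scaled k g s x = 0"
proof -
  define S where "S = {s::real. s < 1 \<longrightarrow> (1 - s) ^ 3 < \<bar>x $ 2\<bar>}"
  \<comment> \<open>The cut-off \<open>max 0 (1 - s)\<close> gives one continuous function of s that
    serves both sides of time 1.\<close>
  have "\<forall>\<^sub>F s in nhds t. max 0 (1 - s) ^ 3 < \<bar>x $ 2\<bar>"
  proof -
    have "isCont (\<lambda>s. max 0 (1 - s) ^ 3) t" by (intro continuous_intros)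
    then have "((\<lambda>s. max 0 (1 - s) ^ 3) \<longlongrightarrow> max 0 (1 - t) ^ 3) (nhds t)"
      using tendsto_at_iff_tendsto_nhds[of "\<lambda>s. max 0 (1 - s) ^ 3" t] unfolding isCont_def by blast
    moreover have "max 0 (1 - t) ^ 3 < \<bar>x $ 2\<bar>" using assms by simp
    ultimately show ?thesis by (rule order_tendstoD)
  qed
  then show ?thesis
  proof (rule eventually_mono)
    fix s assume s: "max 0 (1 - s) ^ 3 < \<bar>x $ 2\<bar>"
    show "scaled k g s x = 0"
    proof (cases "s < 1")
      case True
      have "\<bar>x $ 2\<bar> \<le> norm (x - sin (1 / (1 - s)) *\<^sub>R axis 1 1)"
        using component_le_norm_cart[of "x - sin (1 / (1 - s)) *\<^sub>R axis 1 1" 2] by (simp add: axis_def)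
      then show ?thesis using s True
        by (intro scaled_zero[OF assms(1)]) (simp add: dist_norm norm_minus_commute)
    qed (simp add: scaled_def)
  qed
qed

section \<open>Derivatives of bumps and of test functions\<close>

lemma bump_dir_deriv:
  assumes "smooth g" "bump g" "b \<in> Basis"
  shows "bump (dir_deriv b g)"
  unfolding bump_def
proof (intro conjI allI impI)
  show "continuous_on UNIV (dir_deriv b g)"
    by (rule smooth_continuous_on[OF smooth_dir_deriv[OF assms(1,3)]])
  fix y :: "real^3" assume "1 < norm y"
  then show "dir_deriv b g y = 0"
    by (intro dir_deriv_zero_outside[of "cball 0 1"]) (use assms(2) in \<open>auto simp: bump_def\<close>)
qed

lemma dir_deriv_expand:
  fixes g :: "real^3 \<Rightarrow> 'b::real_normed_vector"
  assumes "g differentiable (at y)"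
  shows "dir_deriv h g y = (\<Sum>i\<in>UNIV. h $ i *\<^sub>R dir_deriv (axis i 1) g y)"
proof -
  have lin: "linear (\<lambda>h. dir_deriv h g y)"
    by (rule has_derivative_linear[OF dir_deriv_has_derivative[OF assms]])
  have "dir_deriv h g y = dir_deriv (\<Sum>i\<in>UNIV. h $ i *\<^sub>R axis i 1) g y"
    using basis_expansion[of h] by (simp add: scalar_mult_eq_scaleR)
  also have "\<dots> = (\<Sum>i\<in>UNIV. h $ i *\<^sub>R dir_deriv (axis i 1) g y)"
    using linear_sum[OF lin, of "\<lambda>i. h $ i *\<^sub>R axis i 1" UNIV] linear_scale[OF lin] by simp
  finally show ?thesis .
qed

lemma axis_in_Basis_real [simp]: "(axis i 1 :: real^'n) \<in> Basis"
  by (simp add: axis_in_Basis_iff)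

text \<open>In \<open>dir_deriv y g y\<close> the direction varies with the point, so continuity is
  obtained by expanding it into derivatives along the three fixed axes.\<close>

lemma bump_radial_deriv:
  assumes "smooth g" "bump g"
  shows "bump (\<lambda>y. g y + 3 *\<^sub>R dir_deriv y g y)"
proof -
  have d: "dir_deriv y g y = (\<Sum>i\<in>UNIV. y $ i *\<^sub>R dir_deriv (axis i 1) g y)" for y
    by (rule dir_deriv_expand[OF smooth_differentiable[OF assms(1)]])
  have b: "bump (dir_deriv (axis i 1) g)" for i
    by (rule bump_dir_deriv[OF assms]) simp
  show ?thesis
    using b assms(2) unfolding bump_def d by (auto intro!: continuous_intros)
qed

lemma zero_outside_supp: "x \<notin> supp \<phi> \<Longrightarrow> \<phi> x = 0"
proof -
  assume "x \<notin> supp \<phi>"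
  then have "x \<notin> {x. \<phi> x \<noteq> 0}"
    unfolding supp_def by (rule contra_subsetD[OF closure_subset])
  then show ?thesis by simp
qed

lemma test_fun_dir_deriv:
  assumes "test_fun \<Omega> \<phi>" "b \<in> Basis"
  shows "test_fun \<Omega> (dir_deriv b \<phi>)"
proof -
  have "supp (dir_deriv b \<phi>) \<subseteq> supp \<phi>"
    unfolding supp_def
  proof (rule closure_minimal)
    show "{x. dir_deriv b \<phi> x \<noteq> 0} \<subseteq> closure {x. \<phi> x \<noteq> 0}"
    proof (rule subsetI, rule ccontr)
      fix x assume x: "x \<in> {x. dir_deriv b \<phi> x \<noteq> 0}" "x \<notin> closure {x. \<phi> x \<noteq> 0}"
      have "dir_deriv b \<phi> x = 0"
        using x(2) by (intro dir_deriv_zero_outside[of "closure {x. \<phi> x \<noteq> 0}"])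
          (auto intro: zero_outside_supp[unfolded supp_def])
      then show False using x(1) by simp
    qed
  qed simp
  moreover from this have "compact (supp (dir_deriv b \<phi>))"
    using assms(1) compact_Int_closed[of "supp \<phi>" "supp (dir_deriv b \<phi>)"]
    by (simp add: test_fun_def supp_def inf.absorb2)
  ultimately show ?thesis
    using assms smooth_dir_deriv unfolding test_fun_def by blast
qed

lemma test_fun_zero: "test_fun \<Omega> \<phi> \<Longrightarrow> x \<notin> \<Omega> \<Longrightarrow> \<phi> x = 0"
  unfolding test_fun_def by (rule zero_outside_supp) blast

lemma test_fun_continuous_on: "test_fun \<Omega> \<phi> \<Longrightarrow> continuous_on S \<phi>"
  unfolding test_fun_def by (rule smooth_continuous_on) simp

lemma test_fun_bounded:
  assumes "test_fun \<Omega> \<phi>"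
  obtains M where "\<And>x. norm (\<phi> x) \<le> M"
proof -
  have "bounded (\<phi> ` supp \<phi>)"
    using assms test_fun_continuous_on[OF assms]
    by (intro compact_imp_bounded compact_continuous_image) (auto simp: test_fun_def)
  then obtain M where M: "\<forall>x\<in>supp \<phi>. norm (\<phi> x) \<le> M"
    unfolding bounded_iff by blast
  have "norm (\<phi> x) \<le> max M 0" for x
    using M closure_subset[of "{x. \<phi> x \<noteq> 0}"] unfolding supp_def
    by (cases "\<phi> x = 0") (auto simp: le_max_iff_disj)
  then show thesis by (rule that)
qed

lemma scaled_slice_isCont:
  assumes "bump g"
  shows "isCont (scaled k g t) x"
proof (cases "t < 1")
  case True
  have "isCont (\<lambda>x. (t, x)) x" by (intro continuous_intros)
  moreover have "isCont (\<lambda>p. scaled k g (fst p) (snd p)) (t, x)"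
    using assms True by (intro scaled_isCont) (auto simp: bump_def)
  ultimately show ?thesis using isCont_o2[of x "\<lambda>x. (t, x)" "\<lambda>p. scaled k g (fst p) (snd p)"] by simp
qed (simp add: scaled_def[abs_def])

lemma scaled_slice_continuous_on: "bump g \<Longrightarrow> continuous_on S (scaled k g t)"
  by (intro continuous_at_imp_continuous_on ballI scaled_slice_isCont)

section \<open>Integration by parts on slices and in space-time\<close>

text \<open>The product with \<phi> has a directional derivative of integral 0, and the product rule
  splits it. The compact support is supplied by the bump at the fixed time t.\<close>

lemma integral_by_parts_space:
  fixes g \<phi> :: "real^3 \<Rightarrow> 'b::euclidean_space"
  assumes g: "smooth g" "bump g" and b: "b \<in> Basis"
    and \<phi>: "\<And>x. \<phi> differentiable (at x)" "continuous_on UNIV (dir_deriv b \<phi>)"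
  shows "(LINT x|lborel. scaled k g t x \<bullet> dir_deriv b \<phi> x) =
    - (LINT x|lborel. scaled (k + 3) (dir_deriv b g) t x \<bullet> \<phi> x)"
proof -
  let ?F = "\<lambda>x. scaled k g t x \<bullet> \<phi> x"
  \<comment> \<open>For t >= 1 the radius is not positive and this ball is a point or empty, which
    is consistent because the field is then zero.\<close>
  let ?K = "cball (sin (1 / (1 - t)) *\<^sub>R axis 1 1) ((1 - t) ^ 3) :: (real^3) set"
  have bd: "bump (dir_deriv b g)" by (rule bump_dir_deriv[OF g b])
  have F: "(?F has_derivative (\<lambda>h. scaled k g t x \<bullet> dir_deriv h \<phi> x + scaled (k + 3) (dir_deriv h g) t x \<bullet> \<phi> x)) (at x)" for x
    by (intro has_derivative_inner scaled_has_derivative smooth_differentiable g dir_deriv_has_derivative \<phi>)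
  have dF: "dir_deriv b ?F = (\<lambda>x. scaled k g t x \<bullet> dir_deriv b \<phi> x + scaled (k + 3) (dir_deriv b g) t x \<bullet> \<phi> x)"
    by (intro ext dir_deriv_eq F)
  have c: "continuous_on UNIV (\<lambda>x. scaled k h t x \<bullet> \<psi> x)" if "bump h" "continuous_on UNIV \<psi>"
    for h \<psi> :: "real^3 \<Rightarrow> 'b" and k
    by (intro continuous_on_inner that scaled_slice_continuous_on)
  have c\<phi>: "continuous_on UNIV \<phi>"
    by (meson continuous_at_imp_continuous_on \<phi>(1) differentiable_imp_continuous_within)
  have i: "integrable lborel (\<lambda>x. scaled k h t x \<bullet> \<psi> x)" if "bump h" "continuous_on UNIV \<psi>"
    for h \<psi> :: "real^3 \<Rightarrow> 'b" and k
  proof -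
    have "integrable lborel (\<lambda>x. indicator ?K x *\<^sub>R (scaled k h t x \<bullet> \<psi> x))"
      by (rule borel_integrable_compact[OF _ continuous_on_subset[OF c[OF that]]]) auto
    moreover have "(\<lambda>x. indicator ?K x *\<^sub>R (scaled k h t x \<bullet> \<psi> x)) = (\<lambda>x. scaled k h t x \<bullet> \<psi> x)"
      using scaled_zero[OF that(1), of _ t k] by (auto simp: fun_eq_iff indicator_def)
    ultimately show ?thesis by simp
  qed
  have "(LINT x|lborel. dir_deriv b ?F x) = 0"
  proof (rule integral_dir_deriv_eq_0)
    show "?F differentiable (at x)" for x using F differentiable_def by blast
    show "continuous_on UNIV (dir_deriv b ?F)"
      unfolding dF by (intro continuous_on_add c g(2) bd \<phi>(2) c\<phi>)
    show "compact ?K" by simp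
    show "?F x = 0" if "x \<notin> ?K" for x using scaled_zero[OF g(2) that] by simp
  qed
  then show ?thesis
    unfolding dF using i[OF g(2) \<phi>(2), of k] i[OF bd c\<phi>, of "k + 3"] by simp
qed

lemma scaled_dt_locally_zero:
  assumes "smooth g" "bump g" "x $ 2 \<noteq> 0" "t \<ge> 1"
  shows "\<forall>\<^sub>F s in nhds t. scaled_dt g s x = 0"
proof -
  have b: "bump (dir_deriv (axis 1 1) g)" by (rule bump_dir_deriv[OF assms(1,2)]) simp
  show ?thesis
    using scaled_locally_zero[OF bump_radial_deriv[OF assms(1,2)] assms(3,4), of 2]
      scaled_locally_zero[OF b assms(3,4), of 6]
    by eventually_elim (simp add: scaled_dt_def)
qed

text \<open>Here the compact support comes from \<phi>. Because x is off the plane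
  \<open>x $ 2 = 0\<close>, the function of t is zero near every t >= 1, hence continuously
  differentiable on the whole line, even across time 1.\<close>

lemma integral_by_parts_time:
  fixes g :: "real^3 \<Rightarrow> 'b::euclidean_space" and \<phi> :: "real \<Rightarrow> 'b"
  assumes g: "smooth g" "bump g" and x: "x $ 2 \<noteq> 0"
    and \<phi>: "\<And>t. \<phi> differentiable (at t)" "continuous_on UNIV (dir_deriv 1 \<phi>)"
    and K: "compact K" "\<And>t. t \<notin> K \<Longrightarrow> \<phi> t = 0"
  shows "(LINT t|lborel. scaled 1 g t x \<bullet> dir_deriv 1 \<phi> t) =
    - (LINT t|lborel. scaled_dt g t x \<bullet> \<phi> t)"
proof -
  let ?F = "\<lambda>t. scaled 1 g t x \<bullet> \<phi> t"
  have gd: "g differentiable (at y)" for y by (rule smooth_differentiable[OF g(1)])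
  have s: "((\<lambda>t. scaled 1 g t x) has_vector_derivative scaled_dt g t x) (at t)" for t
  proof (cases "t < 1")
    case True
    then show ?thesis by (intro scaled_has_vector_derivative gd)
  next
    case False
    then have z: "\<forall>\<^sub>F s in nhds t. scaled 1 g s x = 0" "\<forall>\<^sub>F s in nhds t. scaled_dt g s x = 0"
      using scaled_locally_zero[OF g(2) x] scaled_dt_locally_zero[OF g x] by auto
    have "((\<lambda>t. 0) has_vector_derivative 0) (at t)" by simp
    moreover have "scaled_dt g t x = 0" using z(2) by (rule eventually_nhds_x_imp_x)
    moreover obtain S where "open S" "t \<in> S" "\<And>s. s \<in> S \<Longrightarrow> scaled 1 g s x = 0"
      using z(1) by (auto simp: eventually_nhds)
    ultimately show ?thesis
      using has_vector_derivative_transform_within_open[of "\<lambda>t. 0" 0 t S "\<lambda>t. scaled 1 g t x"] by simp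
  qed
  have sc: "isCont (\<lambda>t. scaled k h t x) t" if "bump h" for k t and h :: "real^3 \<Rightarrow> 'b"
  proof (cases "t < 1")
    case True
    have "isCont (\<lambda>t. (t, x)) t" by (intro continuous_intros)
    moreover have "isCont (\<lambda>p. scaled k h (fst p) (snd p)) (t, x)"
      using that True by (intro scaled_isCont) (auto simp: bump_def)
    ultimately show ?thesis using isCont_o2[of t "\<lambda>t. (t, x)" "\<lambda>p. scaled k h (fst p) (snd p)"] by simp
  next
    case False
    then have "\<forall>\<^sub>F s in nhds t. scaled k h s x = 0" using scaled_locally_zero[OF that x] by simp
    then have "isCont (\<lambda>t. scaled k h t x) t \<longleftrightarrow> isCont (\<lambda>t. 0::'b) t" by (rule isCont_cong)
    then show ?thesis by simp
  qed
  have bd: "bump (dir_deriv (axis 1 1) g)" by (rule bump_dir_deriv[OF g]) simp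
  have dc: "isCont (\<lambda>t. scaled_dt g t x) t" for t
  proof (cases "t < 1")
    case True
    then show ?thesis unfolding scaled_dt_def
      by (intro continuous_intros sc bump_radial_deriv g bd) simp
  next
    case False
    then have "\<forall>\<^sub>F s in nhds t. scaled_dt g s x = 0" using scaled_dt_locally_zero[OF g x] by simp
    then have "isCont (\<lambda>t. scaled_dt g t x) t \<longleftrightarrow> isCont (\<lambda>t. 0::'b) t" by (rule isCont_cong)
    then show ?thesis by simp
  qed
  have F: "(?F has_derivative (\<lambda>h. scaled 1 g t x \<bullet> dir_deriv h \<phi> t + (h *\<^sub>R scaled_dt g t x) \<bullet> \<phi> t)) (at t)" for t
    by (intro has_derivative_inner dir_deriv_has_derivative \<phi> s[unfolded has_vector_derivative_def])
  have dF: "dir_deriv 1 ?F = (\<lambda>t. scaled 1 g t x \<bullet> dir_deriv 1 \<phi> t + scaled_dt g t x \<bullet> \<phi> t)"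
  proof
    fix t
    show "dir_deriv 1 ?F t = scaled 1 g t x \<bullet> dir_deriv 1 \<phi> t + scaled_dt g t x \<bullet> \<phi> t"
      using dir_deriv_eq[OF F[of t], of 1] by simp
  qed
  have c\<phi>: "continuous_on UNIV \<phi>"
    by (meson continuous_at_imp_continuous_on \<phi>(1) differentiable_imp_continuous_within)
  have c: "continuous_on UNIV (\<lambda>t. scaled 1 g t x \<bullet> dir_deriv 1 \<phi> t)" "continuous_on UNIV (\<lambda>t. scaled_dt g t x \<bullet> \<phi> t)"
    using sc[OF g(2)] dc by (intro continuous_on_inner \<phi> c\<phi> continuous_at_imp_continuous_on ballI; blast)+
  have z: "dir_deriv 1 \<phi> t = 0" if "t \<notin> K" for t
    by (rule dir_deriv_zero_outside[OF compact_imp_closed[OF K(1)] K(2) that])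
  have i: "integrable lborel h" if "continuous_on UNIV h" "\<And>t. t \<notin> K \<Longrightarrow> h t = 0" for h :: "real \<Rightarrow> real"
  proof -
    have "integrable lborel (\<lambda>t. indicator K t *\<^sub>R h t)"
      by (rule borel_integrable_compact[OF K(1) continuous_on_subset[OF that(1)]]) simp
    moreover have "(\<lambda>t. indicator K t *\<^sub>R h t) = h" by (auto simp: fun_eq_iff indicator_def that(2))
    ultimately show ?thesis by simp
  qed
  have "(LINT t|lborel. dir_deriv 1 ?F t) = 0"
  proof (rule integral_dir_deriv_eq_0[OF _ _ K(1)])
    show "?F differentiable (at t)" for t using F differentiable_def by blast
    show "continuous_on UNIV (dir_deriv 1 ?F)"
      unfolding dF by (intro continuous_on_add c)
  qed (simp add: K(2))
  then show ?thesis
    unfolding dF using i[OF c(1)] i[OF c(2)] z K(2) by simp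
qed

lemma lborel_integral_fst:
  fixes f :: "'a::euclidean_space \<times> 'b::euclidean_space \<Rightarrow> real"
  assumes "integrable lborel f"
  shows "(LINT p|lborel. f p) = (LINT x|lborel. LINT y|lborel. f (x, y))"
proof -
  have "integrable (lborel \<Otimes>\<^sub>M lborel) f" using assms by (simp add: lborel_prod)
  from lborel_pair.integral_fst'[OF this] show ?thesis by (simp add: lborel_prod)
qed

lemma lborel_integral_snd:
  fixes f :: "'a::euclidean_space \<times> 'b::euclidean_space \<Rightarrow> real"
  assumes "integrable lborel f"
  shows "(LINT p|lborel. f p) = (LINT y|lborel. LINT x|lborel. f (x, y))"
    and "(\<lambda>y. LINT x|lborel. f (x, y)) \<in> borel_measurable lborel"
proof -
  have i: "integrable (lborel \<Otimes>\<^sub>M lborel) (case_prod (\<lambda>x y. f (x, y)))" using assms by (simp add: lborel_prod)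
  from lborel_pair.integral_snd[OF i] show "(LINT p|lborel. f p) = (LINT y|lborel. LINT x|lborel. f (x, y))"
    by (simp add: lborel_prod)
  from lborel_pair.integrable_snd[OF i] show "(\<lambda>y. LINT x|lborel. f (x, y)) \<in> borel_measurable lborel"
    by (rule borel_measurable_integrable)
qed

lemma dir_deriv_slice_snd:
  assumes "\<phi> differentiable (at (t, x))"
  shows "(\<lambda>x. \<phi> (t, x)) differentiable (at x)"
    and "dir_deriv b (\<lambda>x. \<phi> (t, x)) x = dir_deriv (0, b) \<phi> (t, x)"
proof -
  have "((\<lambda>x. (t, x)) has_derivative (\<lambda>h. (0, h))) (at x)"
    by (intro has_derivative_Pair has_derivative_const has_derivative_ident)
  from has_derivative_compose[OF this dir_deriv_has_derivative[OF assms]]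
  have *: "((\<lambda>x. \<phi> (t, x)) has_derivative (\<lambda>h. dir_deriv (0, h) \<phi> (t, x))) (at x)" .
  then show "(\<lambda>x. \<phi> (t, x)) differentiable (at x)" by (rule differentiableI)
  show "dir_deriv b (\<lambda>x. \<phi> (t, x)) x = dir_deriv (0, b) \<phi> (t, x)"
    using dir_deriv_eq[OF *] .
qed

lemma dir_deriv_slice_fst:
  assumes "\<phi> differentiable (at (t, x))"
  shows "(\<lambda>t. \<phi> (t, x)) differentiable (at t)"
    and "dir_deriv b (\<lambda>t. \<phi> (t, x)) t = dir_deriv (b, 0) \<phi> (t, x)"
proof -
  have "((\<lambda>t. (t, x)) has_derivative (\<lambda>h. (h, 0))) (at t)"
    by (intro has_derivative_Pair has_derivative_const has_derivative_ident)
  from has_derivative_compose[OF this dir_deriv_has_derivative[OF assms]]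
  have *: "((\<lambda>t. \<phi> (t, x)) has_derivative (\<lambda>h. dir_deriv (h, 0) \<phi> (t, x))) (at t)" .
  then show "(\<lambda>t. \<phi> (t, x)) differentiable (at t)" by (rule differentiableI)
  show "dir_deriv b (\<lambda>t. \<phi> (t, x)) t = dir_deriv (b, 0) \<phi> (t, x)"
    using dir_deriv_eq[OF *] .
qed

abbreviation (input) spacetime :: "(real \<times> (real^3)) set" where
  "spacetime \<equiv> {0<..} \<times> UNIV"

lemma test_fun_borel_measurable: "test_fun \<Omega> \<phi> \<Longrightarrow> \<phi> \<in> borel_measurable borel"
  by (rule borel_measurable_continuous_onI[OF test_fun_continuous_on])

lemma integrable_scaled_test_fun:
  fixes g :: "real^3 \<Rightarrow> 'b::euclidean_space"
  assumes "bump g" "k \<le> 9" "test_fun spacetime \<phi>"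
  shows "integrable lborel (\<lambda>p. scaled k g (fst p) (snd p) \<bullet> \<phi> p)"
proof -
  obtain M where "\<And>x. norm (\<phi> x) \<le> M" using test_fun_bounded[OF assms(3)] by blast
  moreover have "\<phi> p = 0" if "fst p \<le> 0" for p
    by (rule test_fun_zero[OF assms(3)]) (use that in \<open>auto simp: mem_Times_iff\<close>)
  ultimately show ?thesis
    by (intro integrable_scaled_inner assms test_fun_borel_measurable[OF assms(3)])
qed

lemma space_basis: "b \<in> Basis \<Longrightarrow> (0::real, b::real^3) \<in> Basis"
  by (simp add: Basis_prod_def)

lemma time_basis: "(1::real, 0::real^3) \<in> Basis"
  by (simp add: Basis_prod_def)

lemma test_fun_differentiable: "test_fun \<Omega> \<phi> \<Longrightarrow> \<phi> differentiable (at x)"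
  unfolding test_fun_def by (rule smooth_differentiable) simp

text \<open>Fubini with time outside reduces this to single time slices. The bound k <= 6 keeps the
  differentiated power k + 3 within the integrable range up to 9.\<close>

lemma spacetime_by_parts_space:
  fixes g :: "real^3 \<Rightarrow> 'b::euclidean_space"
  assumes g: "smooth g" "bump g" and b: "b \<in> Basis" and k: "k \<le> 6"
    and \<phi>: "test_fun spacetime \<phi>"
  shows "(LINT p|lborel. scaled k g (fst p) (snd p) \<bullet> dir_deriv (0, b) \<phi> p) =
    - (LINT p|lborel. scaled (k + 3) (dir_deriv b g) (fst p) (snd p) \<bullet> \<phi> p)"
proof -
  have d\<phi>: "test_fun spacetime (dir_deriv (0, b) \<phi>)"
    by (rule test_fun_dir_deriv[OF \<phi> space_basis[OF b]])
  have i1: "integrable lborel (\<lambda>p. scaled k g (fst p) (snd p) \<bullet> dir_deriv (0, b) \<phi> p)"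
    by (rule integrable_scaled_test_fun[OF g(2) _ d\<phi>]) (use k in simp)
  have i2: "integrable lborel (\<lambda>p. scaled (k + 3) (dir_deriv b g) (fst p) (snd p) \<bullet> \<phi> p)"
    by (rule integrable_scaled_test_fun[OF bump_dir_deriv[OF g b] _ \<phi>]) (use k in simp)
  have s: "(LINT x|lborel. scaled k g t x \<bullet> dir_deriv (0, b) \<phi> (t, x)) =
      - (LINT x|lborel. scaled (k + 3) (dir_deriv b g) t x \<bullet> \<phi> (t, x))" for t
  proof -
    have e: "dir_deriv b (\<lambda>x. \<phi> (t, x)) = (\<lambda>x. dir_deriv (0, b) \<phi> (t, x))"
      by (rule ext, rule dir_deriv_slice_snd(2)[OF test_fun_differentiable[OF \<phi>]])
    have c: "continuous_on UNIV (dir_deriv b (\<lambda>x. \<phi> (t, x)))"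
      unfolding e by (rule continuous_on_compose2[OF test_fun_continuous_on[OF d\<phi>, of UNIV]])
        (auto intro!: continuous_intros)
    show ?thesis
      using integral_by_parts_space[OF g b dir_deriv_slice_snd(1)[OF test_fun_differentiable[OF \<phi>]] c]
      unfolding e .
  qed
  show ?thesis
    unfolding lborel_integral_fst[OF i1] lborel_integral_fst[OF i2] by (simp add: s)
qed

lemma AE_component_nonzero: "AE x in lborel. (x::real^'n) $ i \<noteq> 0"
proof -
  have "closed {x::real^'n. x $ i = 0}" by (intro closed_Collect_eq continuous_intros)
  then have "{x::real^'n. x $ i = 0} \<in> sets lborel" by simp
  moreover have "{x::real^'n. x $ i = 0} \<in> null_sets lebesgue"
    using negligible_standard_hyperplane_cart[where k = i] by (simp add: negligible_iff_null_sets)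
  ultimately have "{x::real^'n. x $ i = 0} \<in> null_sets lborel"
    using null_sets_completion_iff by blast
  then show ?thesis by (rule AE_I') auto
qed

lemma integrable_scaled_dt_test_fun:
  fixes g :: "real^3 \<Rightarrow> 'b::euclidean_space"
  assumes g: "smooth g" "bump g" and \<phi>: "test_fun spacetime \<phi>"
  shows "integrable lborel (\<lambda>p. scaled_dt g (fst p) (snd p) \<bullet> \<phi> p)"
proof -
  obtain M where M: "\<And>x. norm (\<phi> x) \<le> M" using test_fun_bounded[OF \<phi>] by blast
  have z: "\<phi> p = 0" if "fst p \<le> 0" for p
    by (rule test_fun_zero[OF \<phi>]) (use that in \<open>auto simp: mem_Times_iff\<close>)
  note test_fun_borel_measurable[OF \<phi>, measurable]
  have "integrable lborel (\<lambda>p. scaled 2 (\<lambda>y. g y + 3 *\<^sub>R dir_deriv y g y) (fst p) (snd p) \<bullet> \<phi> p)"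
    by (rule integrable_scaled_test_fun[OF bump_radial_deriv[OF g] _ \<phi>]) simp
  \<comment> \<open>The cosine is moved onto the test function: it oscillates at time 1, but a
    bounded measurable second factor suffices.\<close>
  moreover have "integrable lborel (\<lambda>p. scaled 6 (dir_deriv (axis 1 1) g) (fst p) (snd p) \<bullet>
      (cos (1 / (1 - fst p)) *\<^sub>R \<phi> p))"
  proof (rule integrable_scaled_inner[OF bump_dir_deriv[OF g]])
    show "(\<lambda>p. cos (1 / (1 - fst p)) *\<^sub>R \<phi> p) \<in> borel_measurable borel" by measurable
    show "norm (cos (1 / (1 - fst p)) *\<^sub>R \<phi> p) \<le> M" for p
    proof -
      have "norm (cos (1 / (1 - fst p)) *\<^sub>R \<phi> p) \<le> norm (\<phi> p)"
        by (simp add: mult_left_le_one_le abs_cos_le_one)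
      then show ?thesis using M order_trans by blast
    qed
    show "cos (1 / (1 - fst p)) *\<^sub>R \<phi> p = 0" if "fst p \<le> 0" for p using z[OF that] by simp
  qed simp_all
  ultimately have "integrable lborel (\<lambda>p. scaled 2 (\<lambda>y. g y + 3 *\<^sub>R dir_deriv y g y) (fst p) (snd p) \<bullet> \<phi> p -
      scaled 6 (dir_deriv (axis 1 1) g) (fst p) (snd p) \<bullet> (cos (1 / (1 - fst p)) *\<^sub>R \<phi> p))"
    by (rule Bochner_Integration.integrable_diff)
  then show ?thesis by (simp add: scaled_dt_def inner_diff_left)
qed

text \<open>For \<open>x $ 2 \<noteq> 0\<close> the support of \<^term>\<open>scaled k g\<close>, which shrinks to the first coordinate axis,
  stays away from \<open>x\<close> for times close to 1, so the singular time does not contribute.\<close>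

lemma spacetime_by_parts_time:
  fixes g :: "real^3 \<Rightarrow> 'b::euclidean_space"
  assumes g: "smooth g" "bump g" and \<phi>: "test_fun spacetime \<phi>"
  shows "(LINT p|lborel. scaled 1 g (fst p) (snd p) \<bullet> dir_deriv (1, 0) \<phi> p) =
    - (LINT p|lborel. scaled_dt g (fst p) (snd p) \<bullet> \<phi> p)"
proof -
  have d\<phi>: "test_fun spacetime (dir_deriv (1, 0) \<phi>)"
    by (rule test_fun_dir_deriv[OF \<phi> time_basis])
  have i1: "integrable lborel (\<lambda>p. scaled 1 g (fst p) (snd p) \<bullet> dir_deriv (1, 0) \<phi> p)"
    by (rule integrable_scaled_test_fun[OF g(2) _ d\<phi>]) simp
  have i2: "integrable lborel (\<lambda>p. scaled_dt g (fst p) (snd p) \<bullet> \<phi> p)"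
    by (rule integrable_scaled_dt_test_fun[OF g \<phi>])
  have s: "(LINT t|lborel. scaled 1 g t x \<bullet> dir_deriv (1, 0) \<phi> (t, x)) =
      - (LINT t|lborel. scaled_dt g t x \<bullet> \<phi> (t, x))" if x: "x $ 2 \<noteq> 0" for x
  proof -
    have e: "dir_deriv 1 (\<lambda>t. \<phi> (t, x)) = (\<lambda>t. dir_deriv (1, 0) \<phi> (t, x))"
      by (rule ext, rule dir_deriv_slice_fst(2)[OF test_fun_differentiable[OF \<phi>]])
    have c: "continuous_on UNIV (dir_deriv 1 (\<lambda>t. \<phi> (t, x)))"
      unfolding e by (rule continuous_on_compose2[OF test_fun_continuous_on[OF d\<phi>, of UNIV]])
        (auto intro!: continuous_intros)
    have K: "compact (fst ` supp \<phi>)"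
      using \<phi> by (intro compact_continuous_image continuous_intros) (simp add: test_fun_def)
    have z: "\<phi> (t, x) = 0" if "t \<notin> fst ` supp \<phi>" for t
      using that by (intro zero_outside_supp) force
    show ?thesis
      using integral_by_parts_time[OF g x dir_deriv_slice_fst(1)[OF test_fun_differentiable[OF \<phi>]] c K z]
      unfolding e by simp
  qed
  \<comment> \<open>Fubini with space outside. The plane \<open>x $ 2 = 0\<close>, which contains
    all the centres, is a null set, so the identity on the other time lines is enough.\<close>
  have "(LINT x|lborel. LINT t|lborel. scaled 1 g t x \<bullet> dir_deriv (1, 0) \<phi> (t, x)) =
      (LINT x|lborel. - (LINT t|lborel. scaled_dt g t x \<bullet> \<phi> (t, x)))"
  proof (rule integral_cong_AE)
    show "(\<lambda>x. LINT t|lborel. scaled 1 g t x \<bullet> dir_deriv (1, 0) \<phi> (t, x)) \<in> borel_measurable lborel"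
      using lborel_integral_snd(2)[OF i1] by simp
    show "(\<lambda>x. - (LINT t|lborel. scaled_dt g t x \<bullet> \<phi> (t, x))) \<in> borel_measurable lborel"
      using lborel_integral_snd(2)[OF i2] by simp
    show "AE x in lborel. (LINT t|lborel. scaled 1 g t x \<bullet> dir_deriv (1, 0) \<phi> (t, x)) =
        - (LINT t|lborel. scaled_dt g t x \<bullet> \<phi> (t, x))"
      using AE_component_nonzero[of 2] by (rule AE_mp) (intro AE_I2 impI s)
  qed
  then show ?thesis
    unfolding lborel_integral_snd(1)[OF i1] lborel_integral_snd(1)[OF i2] by simp
qed

section \<open>Hausdorff measure and singular points\<close>

text \<open>A set in a covering projects into an interval of twice its diameter, which loses a factor 2 but
  avoids taking infima and suprema.\<close>

lemma hausdorff1_pos: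
  fixes A :: "'a::metric_space set" and p :: "'a \<Rightarrow> real"
  assumes p: "\<And>x y. dist (p x) (p y) \<le> dist x y" and A: "{-1..1} \<subseteq> p ` A"
  shows "hausdorff1 A > (0::ennreal)"
proof -
  have "(\<Sum>i. ennreal (diameter (C i))) \<ge> 1"
    if C: "A \<subseteq> (\<Union>i. C i)" "\<And>i. bounded (C i)" for C :: "nat \<Rightarrow> 'a set"
  proof -
    \<comment> \<open>For an empty \<open>C i\<close> this point is arbitrary; the diameter is then
      0 and the interval \<open>I i\<close> is a single point of length 0.\<close>
    define c where "c i = (SOME x. x \<in> C i)" for i
    define I where "I i = {p (c i) - diameter (C i)..p (c i) + diameter (C i)}" for i :: nat
    have "{-1..1} \<subseteq> (\<Union>i. I i)"
    proof
      fix s :: real assume "s \<in> {-1..1}"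
      then obtain x where x: "x \<in> A" "s = p x" using A by blast
      then obtain i where i: "x \<in> C i" using C(1) by blast
      then have "c i \<in> C i" unfolding c_def by (rule someI)
      then have "dist x (c i) \<le> diameter (C i)" using diameter_bounded_bound[OF C(2)] i by blast
      then have "dist (p x) (p (c i)) \<le> diameter (C i)" using p order_trans by blast
      then have "s \<in> I i" unfolding I_def x(2) by (simp add: dist_real_def abs_le_iff)
      then show "s \<in> (\<Union>i. I i)" by blast
    qed
    then have "emeasure lborel {-1..1::real} \<le> emeasure lborel (\<Union>i. I i)"
      by (rule emeasure_mono) (auto simp: I_def)
    also have "\<dots> \<le> (\<Sum>i. emeasure lborel (I i))"
      by (rule emeasure_subadditive_countably) (auto simp: I_def)
    also have "\<dots> = (\<Sum>i. 2 * ennreal (diameter (C i)))"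
    proof (rule arg_cong[where f = suminf], rule ext)
      fix i
      have "0 \<le> diameter (C i)" by (rule diameter_ge_0[OF C(2)])
      then show "emeasure lborel (I i) = 2 * ennreal (diameter (C i))"
        unfolding I_def by (simp add: ennreal_mult' flip: ennreal_numeral)
    qed
    also have "\<dots> = 2 * (\<Sum>i. ennreal (diameter (C i)))" by simp
    finally have "2 * 1 \<le> 2 * (\<Sum>i. ennreal (diameter (C i)))" by simp
    then show ?thesis by (subst (asm) ennreal_mult_le_mult_iff) auto
  qed
  \<comment> \<open>As \<open>hausdorff1\<close> is a supremum over \<delta>, the single value
    \<delta> = 1 suffices for a lower bound.\<close>
  then have "1 \<le> (INF C\<in>{C :: nat \<Rightarrow> 'a set. A \<subseteq> (\<Union>i. C i) \<and> (\<forall>i. bounded (C i) \<and> diameter (C i) \<le> 1)}.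
          \<Sum>i. ennreal (diameter (C i)))"
    by (intro INF_greatest) auto
  also have "\<dots> \<le> hausdorff1 A"
    unfolding hausdorff1_def by (rule SUP_upper) simp
  finally show ?thesis using less_le_trans[OF zero_less_one] by blast
qed

text \<open>If the bound failed at a continuity point, it would fail on a nonempty open subset of U,
  which is not a null set. This turns essential bounds into values at chosen points.\<close>

lemma AE_open_imp_all:
  fixes g :: "'a::euclidean_space \<Rightarrow> real"
  assumes "AE q in lebesgue. q \<in> U \<longrightarrow> g q \<le> C" "open U" "q \<in> U" "isCont g q"
  shows "g q \<le> C"
proof (rule ccontr)
  assume "\<not> g q \<le> C"
  then have "\<forall>\<^sub>F x in nhds q. g x > C"
    using assms(4) by (intro order_tendstoD(1)[of _ "g q"]) (auto simp: tendsto_at_iff_tendsto_nhds[symmetric] isCont_def)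
  then obtain V where V: "open V" "q \<in> V" "\<And>x. x \<in> V \<Longrightarrow> g x > C"
    by (auto simp: eventually_nhds)
  obtain N where N: "N \<in> null_sets lebesgue" "\<And>x. x \<in> space lebesgue - N \<Longrightarrow> x \<in> U \<longrightarrow> g x \<le> C"
    using AE_E3[OF assms(1)] by metis
  have "U \<inter> V \<subseteq> N"
  proof
    fix x assume "x \<in> U \<inter> V"
    then show "x \<in> N" using N(2)[of x] V(3)[of x] by auto
  qed
  then have "negligible (U \<inter> V)"
    using N(1) negligible_iff_null_sets negligible_subset by blast
  moreover have "open (U \<inter> V)" "U \<inter> V \<noteq> {}" using V assms by auto
  ultimately show False using open_not_negligible by blast
qed

section \<open>Energy spaces\<close>

lemma dir_deriv_nth:
  fixes f :: "'a::euclidean_space \<Rightarrow> real^'n"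
  assumes "f differentiable (at x)"
  shows "(\<lambda>y. f y $ j) differentiable (at x)" "dir_deriv b (\<lambda>y. f y $ j) x = dir_deriv b f x $ j"
proof -
  have *: "((\<lambda>y. f y $ j) has_derivative (\<lambda>h. dir_deriv h f x $ j)) (at x)"
    by (rule bounded_linear.has_derivative[OF bounded_linear_vec_nth dir_deriv_has_derivative[OF assms]])
  then show "(\<lambda>y. f y $ j) differentiable (at x)" by (rule differentiableI)
  show "dir_deriv b (\<lambda>y. f y $ j) x = dir_deriv b f x $ j" by (rule dir_deriv_eq[OF *])
qed

lemma smooth_nth:
  fixes f :: "'a::euclidean_space \<Rightarrow> real^'n"
  assumes "smooth f"
  shows "smooth (\<lambda>y. f y $ j)"
proof -
  have d: "iter_deriv bs f differentiable (at x)" if "set bs \<subseteq> Basis" for bs x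
    using assms that unfolding smooth_def by blast
  have e: "iter_deriv bs (\<lambda>y. f y $ j) = (\<lambda>y. iter_deriv bs f y $ j)" if "set bs \<subseteq> Basis" for bs
    using that
  proof (induction bs)
    case (Cons b bs)
    then have IH: "iter_deriv bs (\<lambda>y. f y $ j) = (\<lambda>y. iter_deriv bs f y $ j)" and s: "set bs \<subseteq> Basis"
      by simp_all
    show ?case
      unfolding iter_deriv.simps IH by (rule ext) (rule dir_deriv_nth(2)[OF d[OF s]])
  qed simp
  show ?thesis
    unfolding smooth_def
  proof (intro allI impI)
    fix bs :: "'a list" and x assume bs: "set bs \<subseteq> Basis"
    show "iter_deriv bs (\<lambda>y. f y $ j) differentiable at x"
      unfolding e[OF bs] by (rule dir_deriv_nth(1)[OF d[OF bs]])
  qed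
qed

lemma bump_nth: "bump g \<Longrightarrow> bump (\<lambda>y. g y $ j)"
  unfolding bump_def by (auto intro: continuous_intros)

lemma bump_norm_power: "bump g \<Longrightarrow> 0 < n \<Longrightarrow> bump (\<lambda>y. norm (g y) ^ n)"
  unfolding bump_def by (auto intro!: continuous_intros)

lemma scaled_nth: "scaled k g t x $ j = scaled k (\<lambda>y. g y $ j) t x"
  by (simp add: scaled_def)

text \<open>Lebesgue norms of the field thus become integrals of the same family with k * n in place
  of k. The condition on n makes 0^n = 0, which is the value needed from time 1 on.\<close>

lemma norm_scaled_power:
  "0 < n \<Longrightarrow> norm (scaled k g t x) ^ n = scaled (k * n) (\<lambda>y. norm (g y) ^ n) t x"
  by (simp add: scaled_def power_mult_distrib power_mult power_one_over power_divide)

lemma borel_measurable_lebesgue_onI: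
  fixes h :: "'a::euclidean_space \<Rightarrow> 'b::euclidean_space"
  shows "h \<in> borel_measurable borel \<Longrightarrow> h \<in> borel_measurable (lebesgue_on S)"
  by (intro measurable_restrict_space1 measurable_completion) simp

lemma set_integral_lebesgue_eq_lborel:
  fixes h :: "'a::euclidean_space \<Rightarrow> real"
  assumes "h \<in> borel_measurable borel" "\<And>p. p \<notin> S \<Longrightarrow> h p = 0"
  shows "(LINT p:S|lebesgue. h p) = (LINT p|lborel. h p)"
proof -
  have eq: "indicator S p *\<^sub>R h p = h p" for p using assms(2)[of p] by (cases "p \<in> S") auto
  have "(LINT p:S|lebesgue. h p) = (LINT p|lebesgue. h p)"
    unfolding set_lebesgue_integral_def eq ..
  also have "\<dots> = (LINT p|lborel. h p)"
    by (rule integral_completion) (use assms(1) in simp)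
  finally show ?thesis .
qed

lemma set_integrable_lebesgueI:
  fixes h :: "'a::euclidean_space \<Rightarrow> 'b::euclidean_space"
  assumes "set_integrable lborel T h" "S \<in> sets lebesgue" "S \<subseteq> T"
  shows "set_integrable lebesgue S h"
proof -
  have "set_integrable lebesgue T h"
    using assms(1) unfolding set_integrable_def by (simp add: integrable_completion borel_measurable_integrable)
  then show ?thesis by (rule set_integrable_subset[OF _ assms(2,3)])
qed

lemma set_integrable_scaled:
  fixes g :: "real^3 \<Rightarrow> 'b::euclidean_space"
  assumes "bump g" "k \<le> 9" 
  shows "set_integrable lborel ({0..} \<times> UNIV) (\<lambda>(t, x). scaled k g t x)"
proof -
  have "indicator ({0..} \<times> UNIV) p *\<^sub>R (case p of (t, x) \<Rightarrow> scaled k g t x) =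
      indicator {0..} (fst p) *\<^sub>R scaled k g (fst p) (snd p)" for p
    by (cases p) (simp add: indicator_def)
  then show ?thesis
    unfolding set_integrable_def using integrable_scaled[OF assms] by simp
qed

lemma integrable_scaled_slice:
  fixes g :: "real^3 \<Rightarrow> 'b::euclidean_space"
  assumes "bump g"
  shows "integrable lborel (scaled k g t)"
proof -
  let ?K = "cball (sin (1 / (1 - t)) *\<^sub>R axis 1 1) ((1 - t) ^ 3) :: (real^3) set"
  have "integrable lborel (\<lambda>x. indicator ?K x *\<^sub>R scaled k g t x)"
    by (rule borel_integrable_compact[OF compact_cball scaled_slice_continuous_on[OF assms]])
  moreover have "(\<lambda>x. indicator ?K x *\<^sub>R scaled k g t x) = scaled k g t"
    using scaled_zero[OF assms, of _ t k] by (auto simp: fun_eq_iff indicator_def)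
  ultimately show ?thesis by simp
qed

lemma nn_integral_scaled_slice_le:
  assumes "bump g" "\<And>y. \<bar>g y\<bar> \<le> C" "k \<le> 9" "0 \<le> t"
  shows "(\<integral>\<^sup>+x. ennreal (scaled k g t x) \<partial>lborel) \<le> ennreal (C * unit_ball_vol 3)"
proof -
  have C: "0 \<le> C" using assms(2) abs_ge_zero order_trans by blast
  have "(\<lambda>p. weight (fst p) (snd p)) \<circ> Pair t \<in> borel_measurable borel"
    by (rule measurable_comp[OF _ weight_measurable]) (intro borel_measurable_continuous_onI continuous_intros)
  then have w: "weight t \<in> borel_measurable lborel" by (simp add: comp_def)
  have "(\<integral>\<^sup>+x. ennreal (scaled k g t x) \<partial>lborel) \<le> (\<integral>\<^sup>+x. ennreal C * ennreal (weight t x) \<partial>lborel)"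
  proof (rule nn_integral_mono)
    fix x
    have "scaled k g t x \<le> C * weight t x"
      using scaled_le_weight[of g C t k x] assms by simp
    then show "ennreal (scaled k g t x) \<le> ennreal C * ennreal (weight t x)"
      using C by (simp add: ennreal_leI weight_nonneg flip: ennreal_mult)
  qed
  also have "\<dots> = ennreal C * (\<integral>\<^sup>+x. ennreal (weight t x) \<partial>lborel)"
    using w by (intro nn_integral_cmult) simp
  also have "\<dots> \<le> ennreal C * ennreal (unit_ball_vol 3)"
    unfolding nn_integral_weight by (intro mult_left_mono) auto
  also have "\<dots> = ennreal (C * unit_ball_vol 3)"
    using C by (simp add: ennreal_mult)
  finally show ?thesis .
qed

text \<open>The n-th power of the norm has amplitude power k * n <= 9, so every slice integral is at
  most C times the volume of the unit ball, whatever the time.\<close>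

lemma in_Linf_Lp_scaled:
  assumes g: "bump g" and n: "0 < n" "k * n \<le> 9" and I: "I \<subseteq> {0<..}" and S: "S \<in> sets lebesgue"
  shows "in_Linf_Lp I (real n) S (scaled k g)"
proof -
  let ?h = "\<lambda>y. norm (g y) ^ n"
  have h: "bump ?h" by (rule bump_norm_power[OF g n(1)])
  obtain C where C: "C > 0" "\<And>y. norm (?h y) \<le> C" using bump_bound[OF h] by blast
  have c: "continuous_on UNIV g" using g by (simp add: bump_def)
  have pw: "norm (scaled k g t x) powr real n = scaled (k * n) ?h t x" for t x
    using n(1) by (simp add: powr_realpow' norm_scaled_power)
  have nonneg: "0 \<le> scaled (k * n) ?h t x" for t x by (simp add: scaled_def)
  have i: "integrable lborel (scaled (k * n) ?h t)" for t
    by (rule integrable_scaled_slice[OF h])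
  have "(\<lambda>(t, x). scaled k g t x) \<in> borel_measurable (lebesgue_on (I \<times> S))"
    using borel_measurable_lebesgue_onI[OF scaled_measurable[OF c, of k]] by (simp add: case_prod_beta')
  moreover have "in_Lp (real n) S (scaled k g t) \<and> Lp_norm (real n) S (scaled k g t) \<le>
      (C * unit_ball_vol 3) powr (1 / real n)" if "t \<in> I" for t
  proof
    have "scaled k g t \<in> borel_measurable borel"
      by (rule borel_measurable_continuous_onI[OF scaled_slice_continuous_on[OF g]])
    moreover have si: "set_integrable lebesgue S (scaled (k * n) ?h t)"
      by (rule set_integrable_lebesgueI[of UNIV]) (use i S in \<open>auto simp: set_integrable_def\<close>)
    ultimately show "in_Lp (real n) S (scaled k g t)"
      unfolding in_Lp_def pw by (intro conjI borel_measurable_lebesgue_onI) simp_all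
    have "(LINT x:S|lebesgue. scaled (k * n) ?h t x) \<le> (LINT x|lebesgue. scaled (k * n) ?h t x)"
      unfolding set_lebesgue_integral_def
    proof (rule integral_mono)
      show "integrable lebesgue (\<lambda>x. indicator S x *\<^sub>R scaled (k * n) ?h t x)"
        using si by (simp add: set_integrable_def)
      show "integrable lebesgue (scaled (k * n) ?h t)"
        using i by (simp add: integrable_completion borel_measurable_integrable)
    qed (use nonneg in \<open>auto simp: indicator_def\<close>)
    also have "\<dots> = (LINT x|lborel. scaled (k * n) ?h t x)"
      by (rule integral_completion) (rule borel_measurable_integrable[OF i])
    also have "\<dots> \<le> C * unit_ball_vol 3"
    proof -
      have "ennreal (LINT x|lborel. scaled (k * n) ?h t x) = (\<integral>\<^sup>+x. ennreal (scaled (k * n) ?h t x) \<partial>lborel)"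
        by (rule nn_integral_eq_integral[symmetric, OF i]) (simp add: nonneg)
      also have "\<dots> \<le> ennreal (C * unit_ball_vol 3)"
        by (rule nn_integral_scaled_slice_le[OF h _ n(2)]) (use C that I in auto)
      finally show ?thesis using C by (subst (asm) ennreal_le_iff) auto
    qed
    finally have "(LINT x:S|lebesgue. scaled (k * n) ?h t x) \<le> C * unit_ball_vol 3" .
    moreover have "0 \<le> (LINT x:S|lebesgue. scaled (k * n) ?h t x)"
      unfolding set_lebesgue_integral_def by (intro integral_nonneg_AE AE_I2) (simp add: nonneg)
    ultimately show "Lp_norm (real n) S (scaled k g t) \<le> (C * unit_ball_vol 3) powr (1 / real n)"
      unfolding Lp_norm_def pw by (intro powr_mono2) auto
  qed
  ultimately show ?thesis unfolding in_Linf_Lp_def by blast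
qed

text \<open>Component index first, direction second, to match the convention of
  \<open>has_weak_gradient\<close>.\<close>

definition jacobian :: "(real^3 \<Rightarrow> real^3) \<Rightarrow> real^3 \<Rightarrow> real^3^3" where
  "jacobian g y = (\<chi> j i. dir_deriv (axis i 1) g y $ j)"

lemma bump_jacobian:
  assumes "smooth g" "bump g"
  shows "bump (jacobian g)"
proof -
  have b: "bump (dir_deriv (axis i 1) g)" for i
    by (rule bump_dir_deriv[OF assms]) simp
  have "continuous_on UNIV (jacobian g)"
    unfolding jacobian_def using b by (intro continuous_intros) (simp add: bump_def)
  moreover have "jacobian g y = 0" if "1 < norm y" for y
    using b that by (simp add: jacobian_def bump_def vec_eq_iff)
  ultimately show ?thesis by (simp add: bump_def)
qed

lemma locally_integrable_on_UNIV_I: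
  fixes h :: "'a::euclidean_space \<Rightarrow> 'b::euclidean_space"
  assumes "integrable lborel h"
  shows "h locally_integrable_on UNIV"
  unfolding locally_integrable_on_def
proof (intro allI impI)
  fix K :: "'a set" assume K: "compact K \<and> K \<subseteq> UNIV"
  show "set_integrable lebesgue K h"
    by (rule set_integrable_lebesgueI[of UNIV])
      (use assms K in \<open>auto simp: set_integrable_def compact_imp_closed\<close>)
qed

text \<open>Each slice is smooth, so its classical gradient is its weak gradient. The proof is
  scalar integration by parts in each component, valid at every time and not just almost every
  one.\<close>

lemma weak_gradient_scaled:
  assumes g: "smooth g" "bump g"
  shows "has_weak_gradient (scaled k g t) (scaled (k + 3) (jacobian g) t)"
  unfolding has_weak_gradient_def
proof (intro conjI allI impI)
  show "scaled k g t locally_integrable_on UNIV"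
    by (rule locally_integrable_on_UNIV_I[OF integrable_scaled_slice[OF g(2)]])
  show "scaled (k + 3) (jacobian g) t locally_integrable_on UNIV"
    by (rule locally_integrable_on_UNIV_I[OF integrable_scaled_slice[OF bump_jacobian[OF g]]])
  fix \<phi> :: "real^3 \<Rightarrow> real" and i j assume \<phi>: "test_fun UNIV \<phi>"
  let ?g = "\<lambda>y. g y $ j"
  have d: "test_fun UNIV (dir_deriv (axis i 1) \<phi>)" by (rule test_fun_dir_deriv[OF \<phi>]) simp
  have m: "scaled l h t \<in> borel_measurable borel" if "bump h" for l and h :: "real^3 \<Rightarrow> real"
    by (rule borel_measurable_continuous_onI[OF scaled_slice_continuous_on[OF that]])
  have ibp: "(LINT x|lborel. scaled k ?g t x * dir_deriv (axis i 1) \<phi> x) =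
      - (LINT x|lborel. scaled (k + 3) (dir_deriv (axis i 1) ?g) t x * \<phi> x)"
    using integral_by_parts_space[OF smooth_nth[OF g(1), of j] bump_nth[OF g(2), of j] axis_in_Basis_real
        test_fun_differentiable[OF \<phi>] test_fun_continuous_on[OF d], of k t] by simp
  have e: "dir_deriv (axis i 1) ?g = (\<lambda>y. jacobian g y $ j $ i)"
    by (rule ext) (simp add: jacobian_def dir_deriv_nth(2)[OF smooth_differentiable[OF g(1)]])
  have bd: "bump (dir_deriv (axis i 1) ?g)"
    by (rule bump_dir_deriv[OF smooth_nth[OF g(1)] bump_nth[OF g(2)]]) simp
  have "(LINT x|lebesgue. scaled k ?g t x * dir_deriv (axis i 1) \<phi> x) =
      (LINT x|lborel. scaled k ?g t x * dir_deriv (axis i 1) \<phi> x)"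
    using m[OF bump_nth[OF g(2)]] test_fun_borel_measurable[OF d] by (intro integral_completion) simp
  moreover have "(LINT x|lebesgue. scaled (k + 3) (dir_deriv (axis i 1) ?g) t x * \<phi> x) =
      (LINT x|lborel. scaled (k + 3) (dir_deriv (axis i 1) ?g) t x * \<phi> x)"
    using m[OF bd] test_fun_borel_measurable[OF \<phi>] by (intro integral_completion) simp
  ultimately show "(LINT x|lebesgue. scaled k g t x $ j * dir_deriv (axis i 1) \<phi> x) =
      - (LINT x|lebesgue. scaled (k + 3) (jacobian g) t x $ j $ i * \<phi> x)"
    using ibp unfolding scaled_nth e[symmetric] by simp
qed

lemma spatial_gradient_scaled:
  assumes g: "smooth g" "bump g"
  shows "has_spatial_gradient I (scaled k g) (scaled (k + 3) (jacobian g))"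
proof -
  have "continuous_on UNIV (jacobian g)" using bump_jacobian[OF g] by (simp add: bump_def)
  from borel_measurable_lebesgue_onI[OF scaled_measurable[OF this, of "k + 3"]]
  show ?thesis
    unfolding has_spatial_gradient_def using weak_gradient_scaled[OF g]
    by (simp add: case_prod_beta')
qed

lemma in_L2_H1_scaled:
  assumes g: "smooth g" "bump g" and I: "I \<subseteq> {0<..}" "I \<in> sets borel"
  shows "in_L2_H1 I (scaled 1 g)"
proof -
  have S: "I \<times> (UNIV :: (real^3) set) \<in> sets lebesgue"
  proof -
    have "I \<times> (UNIV :: (real^3) set) \<in> sets (borel \<Otimes>\<^sub>M borel)" using I(2) by simp
    then have "I \<times> (UNIV :: (real^3) set) \<in> sets borel" by (simp only: borel_prod)
    then show ?thesis by simp
  qed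
  have sub: "I \<times> (UNIV :: (real^3) set) \<subseteq> {0..} \<times> UNIV" using I(1) by force
  have i1: "set_integrable lebesgue (I \<times> UNIV) (\<lambda>(t, x). scaled 2 (\<lambda>y. norm (g y) ^ 2) t x)"
    by (rule set_integrable_lebesgueI[OF set_integrable_scaled S sub])
      (use bump_norm_power[OF g(2), of 2] in simp_all)
  \<comment> \<open>The exponent 8 = (1 + 3) * 2 belongs to the squared gradient; it still lies
    below 9.\<close>
  have i2: "set_integrable lebesgue (I \<times> UNIV) (\<lambda>(t, x). scaled 8 (\<lambda>y. norm (jacobian g y) ^ 2) t x)"
    by (rule set_integrable_lebesgueI[OF set_integrable_scaled S sub])
      (use bump_norm_power[OF bump_jacobian[OF g], of 2] in simp_all)
  have "set_integrable lebesgue (I \<times> UNIV)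
      (\<lambda>(t, x). (norm (scaled 1 g t x))\<^sup>2 + (norm (scaled (1 + 3) (jacobian g) t x))\<^sup>2)"
    using set_integral_add(1)[OF i1 i2] by (simp add: norm_scaled_power case_prod_beta')
  moreover have "(\<lambda>(t, x). scaled 1 g t x) \<in> borel_measurable (lebesgue_on (I \<times> UNIV))"
    using borel_measurable_lebesgue_onI[OF scaled_measurable[of g 1]] g(2)
    by (simp add: case_prod_beta' bump_def)
  ultimately show ?thesis
    unfolding in_L2_H1_def using spatial_gradient_scaled[OF g] by blast
qed

section \<open>The Stokes system with zero pressure\<close>

text \<open>The heat residual of \<open>scaled 1 g\<close>; the index 7 = 1 + 3 + 3 counts two space
  derivatives.\<close>

definition scaled_force :: "(real^3 \<Rightarrow> 'b::real_normed_vector) \<Rightarrow> real \<Rightarrow> real^3 \<Rightarrow> 'b" where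
  "scaled_force g t x = scaled_dt g t x -
     (\<Sum>i\<in>UNIV. scaled 7 (dir_deriv (axis i 1) (dir_deriv (axis i 1) g)) t x)"

lemma scaled_measurable_bump:
  fixes g :: "real^3 \<Rightarrow> 'b::euclidean_space"
  shows "bump g \<Longrightarrow> (\<lambda>p. scaled k g (fst p) (snd p)) \<in> borel_measurable borel"
  by (rule scaled_measurable) (simp add: bump_def)

lemma scaled_dt_measurable:
  fixes g :: "real^3 \<Rightarrow> 'b::euclidean_space"
  assumes "smooth g" "bump g"
  shows "(\<lambda>p. scaled_dt g (fst p) (snd p)) \<in> borel_measurable borel"
proof -
  note scaled_measurable_bump[OF bump_radial_deriv[OF assms], measurable]
  note scaled_measurable_bump[OF bump_dir_deriv[OF assms axis_in_Basis_real], measurable]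
  show ?thesis unfolding scaled_dt_def by measurable
qed

lemma scaled_force_measurable:
  fixes g :: "real^3 \<Rightarrow> 'b::euclidean_space"
  assumes "smooth g" "bump g"
  shows "(\<lambda>p. scaled_force g (fst p) (snd p)) \<in> borel_measurable borel"
proof -
  have "bump (dir_deriv (axis i 1) (dir_deriv (axis i 1) g))" for i
    by (intro bump_dir_deriv smooth_dir_deriv assms axis_in_Basis_real)
  note scaled_measurable_bump[OF this, measurable]
  note scaled_dt_measurable[OF assms, measurable]
  show ?thesis unfolding scaled_force_def by measurable
qed

lemma set_integrable_scaled_force:
  fixes g :: "real^3 \<Rightarrow> 'b::euclidean_space"
  assumes "smooth g" "bump g"
  shows "set_integrable lborel ({0..} \<times> UNIV) (\<lambda>(t, x). scaled_force g t x)"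
proof -
  let ?S = "{0..} \<times> UNIV :: (real \<times> (real^3)) set"
  let ?e = "dir_deriv (axis 1 1) g"
  have b: "bump (dir_deriv (axis i 1) (dir_deriv (axis i 1) g))" for i
    by (intro bump_dir_deriv smooth_dir_deriv assms axis_in_Basis_real)
  have be: "bump ?e" by (intro bump_dir_deriv assms axis_in_Basis_real)
  have 1: "set_integrable lborel ?S (\<lambda>(t, x). scaled 2 (\<lambda>y. g y + 3 *\<^sub>R dir_deriv y g y) t x)"
    by (rule set_integrable_scaled[OF bump_radial_deriv[OF assms]]) simp
  \<comment> \<open>The cosine is bounded by 1 and measurable, so this term is dominated by the one
    without it.\<close>
  have 2: "set_integrable lborel ?S (\<lambda>(t, x). cos (1 / (1 - t)) *\<^sub>R scaled 6 ?e t x)"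
    unfolding set_integrable_def
  proof (rule Bochner_Integration.integrable_bound)
    show "integrable lborel (\<lambda>p. indicator ?S p *\<^sub>R (case p of (t, x) \<Rightarrow> scaled 6 ?e t x))"
      using set_integrable_scaled[OF be, of 6] by (simp add: set_integrable_def)
    note scaled_measurable_bump[OF be, measurable]
    have [measurable]: "?S \<in> sets borel" by (intro borel_closed closed_Times) auto
    show "(\<lambda>p. indicator ?S p *\<^sub>R (case p of (t, x) \<Rightarrow> cos (1 / (1 - t)) *\<^sub>R scaled 6 ?e t x)) \<in> borel_measurable lborel"
      unfolding case_prod_beta' by measurable
    have "norm (cos (1 / (1 - t)) *\<^sub>R scaled 6 ?e t x) \<le> norm (scaled 6 ?e t x)" for t x
      by (simp add: mult_left_le_one_le abs_cos_le_one)
    then show "AE p in lborel. norm (indicator ?S p *\<^sub>R (case p of (t, x) \<Rightarrow> cos (1 / (1 - t)) *\<^sub>R scaled 6 ?e t x))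
        \<le> norm (indicator ?S p *\<^sub>R (case p of (t, x) \<Rightarrow> scaled 6 ?e t x))"
      by (intro AE_I2) (simp add: case_prod_beta' indicator_def)
  qed
  have 3: "set_integrable lborel ?S (\<lambda>p. \<Sum>i\<in>UNIV. case p of (t, x) \<Rightarrow>
      scaled 7 (dir_deriv (axis i 1) (dir_deriv (axis i 1) g)) t x)"
    unfolding set_integrable_def scaleR_sum_right
    by (intro Bochner_Integration.integrable_sum set_integrable_scaled[unfolded set_integrable_def] b) simp
  show ?thesis
    using set_integral_diff(1)[OF set_integral_diff(1)[OF 1 2] 3]
    by (simp add: scaled_force_def scaled_dt_def case_prod_beta')
qed

text \<open>All derivatives are moved from the test function to the field: one sign change in time,
  which cancels the minus in front of \<open>dt\<close>, and two in each space direction, with the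
  powers going 1, 4, 7.\<close>

lemma stokes_momentum:
  fixes g :: "real^3 \<Rightarrow> real^3"
  assumes g: "smooth g" "bump g" and \<phi>: "test_fun spacetime \<phi>"
  shows "(LINT (t, x):spacetime|lebesgue. scaled 1 g t x \<bullet> (- dt \<phi> (t, x) - lapl \<phi> (t, x))) =
    (LINT (t, x):spacetime|lebesgue. scaled_force g t x \<bullet> \<phi> (t, x))"
proof -
  define D where "D i = dir_deriv (axis i 1) (dir_deriv (axis i 1) g)" for i
  have D: "bump (D i)" for i
    unfolding D_def by (intro bump_dir_deriv smooth_dir_deriv g axis_in_Basis_real)
  have b: "(0::real, axis i 1 :: real^3) \<in> Basis" for i by (rule space_basis) simp
  have t1: "test_fun spacetime (dt \<phi>)" unfolding dt_def by (rule test_fun_dir_deriv[OF \<phi> time_basis])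
  have tx: "test_fun spacetime (dx i \<phi>)" for i unfolding dx_def by (rule test_fun_dir_deriv[OF \<phi> b])
  have txx: "test_fun spacetime (dx i (dx i \<phi>))" for i
    using test_fun_dir_deriv[OF tx b] by (simp add: dx_def)
  have z: "\<psi> p = 0" if "test_fun spacetime \<psi>" "p \<notin> spacetime" for \<psi> :: "_ \<Rightarrow> real^3" and p
    by (rule test_fun_zero[OF that])
  note [measurable] = scaled_measurable_bump[OF g(2)] scaled_force_measurable[OF g]
    test_fun_borel_measurable[OF \<phi>] test_fun_borel_measurable[OF t1] test_fun_borel_measurable[OF txx]
  have x: "(LINT p|lborel. scaled 1 g (fst p) (snd p) \<bullet> dx i (dx i \<phi>) p) =
      (LINT p|lborel. scaled 7 (D i) (fst p) (snd p) \<bullet> \<phi> p)" for i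
  proof -
    have "(LINT p|lborel. scaled 1 g (fst p) (snd p) \<bullet> dx i (dx i \<phi>) p) =
        - (LINT p|lborel. scaled 4 (dir_deriv (axis i 1) g) (fst p) (snd p) \<bullet> dx i \<phi> p)"
      using spacetime_by_parts_space[OF g axis_in_Basis_real[of i] _ tx, of 1 i] by (simp add: dx_def)
    also have "(LINT p|lborel. scaled 4 (dir_deriv (axis i 1) g) (fst p) (snd p) \<bullet> dx i \<phi> p) =
        - (LINT p|lborel. scaled 7 (D i) (fst p) (snd p) \<bullet> \<phi> p)"
      using spacetime_by_parts_space[OF smooth_dir_deriv[OF g(1) axis_in_Basis_real[of i]]
          bump_dir_deriv[OF g axis_in_Basis_real[of i]] axis_in_Basis_real[of i] _ \<phi>, of 4]
      by (simp add: dx_def D_def)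
    finally show ?thesis by simp
  qed
  have "(LINT (t, x):spacetime|lebesgue. scaled 1 g t x \<bullet> (- dt \<phi> (t, x) - lapl \<phi> (t, x))) =
      (LINT p|lborel. scaled 1 g (fst p) (snd p) \<bullet> (- dt \<phi> p - lapl \<phi> p))"
    unfolding case_prod_beta' prod.collapse
  proof (rule set_integral_lebesgue_eq_lborel)
    show "(\<lambda>p. scaled 1 g (fst p) (snd p) \<bullet> (- dt \<phi> p - lapl \<phi> p)) \<in> borel_measurable borel"
      unfolding lapl_def by measurable
  qed (simp add: lapl_def z[OF t1] z[OF txx])
  also have "\<dots> = (LINT p|lborel. - (scaled 1 g (fst p) (snd p) \<bullet> dt \<phi> p) -
      (\<Sum>i\<in>UNIV. scaled 1 g (fst p) (snd p) \<bullet> dx i (dx i \<phi>) p))"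
    by (simp add: lapl_def inner_diff_right inner_sum_right)
  also have "\<dots> = - (LINT p|lborel. scaled 1 g (fst p) (snd p) \<bullet> dt \<phi> p) -
      (\<Sum>i\<in>UNIV. LINT p|lborel. scaled 1 g (fst p) (snd p) \<bullet> dx i (dx i \<phi>) p)"
    using integrable_scaled_test_fun[OF g(2) _ t1, of 1] integrable_scaled_test_fun[OF g(2) _ txx, of 1] by simp
  also have "\<dots> = (LINT p|lborel. scaled_dt g (fst p) (snd p) \<bullet> \<phi> p) -
      (\<Sum>i\<in>UNIV. LINT p|lborel. scaled 7 (D i) (fst p) (snd p) \<bullet> \<phi> p)"
    unfolding x using spacetime_by_parts_time[OF g \<phi>] by (simp add: dt_def)
  also have "\<dots> = (LINT p|lborel. scaled_dt g (fst p) (snd p) \<bullet> \<phi> p -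
      (\<Sum>i\<in>UNIV. scaled 7 (D i) (fst p) (snd p) \<bullet> \<phi> p))"
    using integrable_scaled_dt_test_fun[OF g \<phi>] integrable_scaled_test_fun[OF D _ \<phi>, of 7] by simp
  also have "\<dots> = (LINT p|lborel. scaled_force g (fst p) (snd p) \<bullet> \<phi> p)"
    by (simp add: scaled_force_def D_def inner_diff_left inner_sum_left)
  also have "\<dots> = (LINT (t, x):spacetime|lebesgue. scaled_force g t x \<bullet> \<phi> (t, x))"
    unfolding case_prod_beta' prod.collapse
  proof (rule set_integral_lebesgue_eq_lborel[symmetric])
    show "(\<lambda>p. scaled_force g (fst p) (snd p) \<bullet> \<phi> p) \<in> borel_measurable borel" by measurable
  qed (simp add: z[OF \<phi>])
  finally show ?thesis .
qed

text \<open>Integrating by parts in each component turns the pairing with the gradient into a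
  pairing with the divergence of the field, which is (1 / (1 - t))^4 times the divergence of g at
  the rescaled point.\<close>

lemma stokes_divergence:
  fixes g :: "real^3 \<Rightarrow> real^3"
  assumes g: "smooth g" "bump g" and div: "\<And>y. (\<Sum>i\<in>UNIV. dir_deriv (axis i 1) g y $ i) = 0"
    and \<psi>: "test_fun spacetime \<psi>"
  shows "(LINT (t, x):spacetime|lebesgue. scaled 1 g t x \<bullet> grad \<psi> (t, x)) = 0"
proof -
  let ?g = "\<lambda>i y. g y $ i"
  have b: "(0::real, axis i 1 :: real^3) \<in> Basis" for i by (rule space_basis) simp
  have tx: "test_fun spacetime (dx i \<psi>)" for i unfolding dx_def by (rule test_fun_dir_deriv[OF \<psi> b])
  have gi: "smooth (?g i)" "bump (?g i)" for i by (rule smooth_nth[OF g(1)], rule bump_nth[OF g(2)])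
  have D: "bump (dir_deriv (axis i 1) (?g i))" for i by (intro bump_dir_deriv gi axis_in_Basis_real)
  note [measurable] = scaled_measurable_bump[OF gi(2)] test_fun_borel_measurable[OF tx]
  have e: "scaled 1 g t x \<bullet> grad \<psi> p = (\<Sum>i\<in>UNIV. scaled 1 (?g i) t x \<bullet> dx i \<psi> p)" for t x p
    by (simp add: inner_vec_def grad_def scaled_nth)
  have s: "(\<Sum>i\<in>UNIV. scaled 4 (dir_deriv (axis i 1) (?g i)) t x) = 0" for t x
  proof -
    have "(\<Sum>i\<in>UNIV. scaled 4 (dir_deriv (axis i 1) (?g i)) t x) =
        scaled 4 (\<lambda>y. \<Sum>i\<in>UNIV. dir_deriv (axis i 1) (?g i) y) t x"
      by (simp add: scaled_def sum_distrib_left)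
    also have "(\<lambda>y. \<Sum>i\<in>UNIV. dir_deriv (axis i 1) (?g i) y) = (\<lambda>y. 0)"
      by (simp add: dir_deriv_nth(2)[OF smooth_differentiable[OF g(1)]] div)
    finally show ?thesis by (simp add: scaled_def)
  qed
  have "(LINT (t, x):spacetime|lebesgue. scaled 1 g t x \<bullet> grad \<psi> (t, x)) =
      (LINT p|lborel. (\<Sum>i\<in>UNIV. scaled 1 (?g i) (fst p) (snd p) \<bullet> dx i \<psi> p))"
    unfolding case_prod_beta' prod.collapse e
  proof (rule set_integral_lebesgue_eq_lborel)
    show "(\<lambda>p. \<Sum>i\<in>UNIV. scaled 1 (?g i) (fst p) (snd p) \<bullet> dx i \<psi> p) \<in> borel_measurable borel"
      by measurable
  qed (simp add: test_fun_zero[OF tx])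
  also have "\<dots> = (\<Sum>i\<in>UNIV. LINT p|lborel. scaled 1 (?g i) (fst p) (snd p) \<bullet> dx i \<psi> p)"
    by (intro Bochner_Integration.integral_sum integrable_scaled_test_fun gi tx) simp
  also have "\<dots> = - (\<Sum>i\<in>UNIV. LINT p|lborel. scaled 4 (dir_deriv (axis i 1) (?g i)) (fst p) (snd p) \<bullet> \<psi> p)"
    unfolding dx_def sum_negf[symmetric]
    by (intro sum.cong refl) (use spacetime_by_parts_space[OF gi axis_in_Basis_real _ \<psi>, of 1] in simp)
  also have "(\<Sum>i\<in>UNIV. LINT p|lborel. scaled 4 (dir_deriv (axis i 1) (?g i)) (fst p) (snd p) \<bullet> \<psi> p) =
      (LINT p|lborel. (\<Sum>i\<in>UNIV. scaled 4 (dir_deriv (axis i 1) (?g i)) (fst p) (snd p) \<bullet> \<psi> p))"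
    by (intro Bochner_Integration.integral_sum[symmetric] integrable_scaled_test_fun D \<psi>) simp
  also have "\<dots> = 0"
    unfolding inner_sum_left[symmetric] s by simp
  finally show ?thesis by simp
qed

text \<open>The initial time is far from the singular one: the field is jointly continuous before
  time 1, so dominated convergence applies.\<close>

lemma scaled_initial_limit:
  fixes g :: "real^3 \<Rightarrow> real^3"
  assumes g: "bump g" and \<phi>: "test_fun UNIV \<phi>"
  shows "((\<lambda>t. LINT x|lebesgue. scaled 1 g t x \<bullet> \<phi> x) \<longlongrightarrow> (LINT x|lebesgue. scaled 1 g 0 x \<bullet> \<phi> x)) (at_right 0)"
proof (rule tendsto_at_right_sequentially[of _ "1/2"])
  obtain C where C: "C > 0" "\<And>y. norm (g y) \<le> C" using bump_bound[OF g] by blast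
  have m: "scaled 1 g t \<in> borel_measurable borel" for t
    by (rule borel_measurable_continuous_onI[OF scaled_slice_continuous_on[OF g]])
  note [measurable] = m test_fun_borel_measurable[OF \<phi>]
  have i: "integrable lborel \<phi>"
  proof -
    have "integrable lborel (\<lambda>x. indicator (supp \<phi>) x *\<^sub>R \<phi> x)"
      by (rule borel_integrable_compact[OF _ test_fun_continuous_on[OF \<phi>]])
        (use \<phi> in \<open>simp add: test_fun_def\<close>)
    moreover have "(\<lambda>x. indicator (supp \<phi>) x *\<^sub>R \<phi> x) = \<phi>"
      by (auto simp: fun_eq_iff indicator_def zero_outside_supp)
    ultimately show ?thesis by simp
  qed
  have eq: "(LINT x|lebesgue. scaled 1 g t x \<bullet> \<phi> x) = (LINT x|lborel. scaled 1 g t x \<bullet> \<phi> x)" for t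
    by (rule integral_completion) measurable
  fix S :: "nat \<Rightarrow> real"
  assume S: "\<And>n. 0 < S n" "\<And>n. S n < 1/2" "S \<longlonglongrightarrow> 0"
  show "(\<lambda>n. LINT x|lebesgue. scaled 1 g (S n) x \<bullet> \<phi> x) \<longlonglongrightarrow> (LINT x|lebesgue. scaled 1 g 0 x \<bullet> \<phi> x)"
    unfolding eq
  \<comment> \<open>For times below 1/2 the amplitude 1 / (1 - t) is less than 2, which gives the
    factor 2 in the dominating function.\<close>
  proof (rule integral_dominated_convergence[where w = "\<lambda>x. 2 * C * norm (\<phi> x)"])
    show "integrable lborel (\<lambda>x. 2 * C * norm (\<phi> x))" using i by simp
    show "AE x in lborel. (\<lambda>n. scaled 1 g (S n) x \<bullet> \<phi> x) \<longlonglongrightarrow> scaled 1 g 0 x \<bullet> \<phi> x"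
    proof (rule AE_I2)
      fix x
      have "isCont (\<lambda>p. scaled 1 g (fst p) (snd p)) (0, x)"
        using g by (intro scaled_isCont) (auto simp: bump_def)
      moreover have "(\<lambda>n. (S n, x)) \<longlonglongrightarrow> (0, x)" by (intro tendsto_intros S)
      ultimately have "(\<lambda>n. scaled 1 g (S n) x) \<longlonglongrightarrow> scaled 1 g 0 x"
        using isCont_tendsto_compose by fastforce
      then show "(\<lambda>n. scaled 1 g (S n) x \<bullet> \<phi> x) \<longlonglongrightarrow> scaled 1 g 0 x \<bullet> \<phi> x"
        by (intro tendsto_intros)
    qed
    show "AE x in lborel. norm (scaled 1 g (S n) x \<bullet> \<phi> x) \<le> 2 * C * norm (\<phi> x)" for n
    proof (rule AE_I2)
      fix x
      have "norm (scaled 1 g (S n) x) = 1 / (1 - S n) * norm (g (profile_coord (S n) x))"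
        using S(2)[of n] by (simp add: scaled_def)
      also have "\<dots> \<le> 2 * C"
        using S(2)[of n] by (intro mult_mono C) (auto simp: field_simps)
      finally have "norm (scaled 1 g (S n) x) * norm (\<phi> x) \<le> 2 * C * norm (\<phi> x)"
        by (rule mult_right_mono) simp
      then show "norm (scaled 1 g (S n) x \<bullet> \<phi> x) \<le> 2 * C * norm (\<phi> x)"
        using Cauchy_Schwarz_ineq2[of "scaled 1 g (S n) x" "\<phi> x"] by simp
    qed
  qed measurable
qed simp

lemma is_distribution_zero: "is_distribution \<Omega> (\<lambda>\<phi>. 0)"
  unfolding is_distribution_def by (auto intro!: exI[of _ 0])

lemma stokes_solution_scaled:
  assumes g: "smooth g" "bump g" and div: "\<And>y. (\<Sum>i\<in>UNIV. dir_deriv (axis i 1) g y $ i) = 0"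
  shows "stokes_solution (scaled 1 g 0) (scaled_force g) (scaled 1 g)"
proof -
  have K: "set_integrable lebesgue K h"
    if "compact K" "K \<subseteq> {0..} \<times> UNIV" "set_integrable lborel ({0..} \<times> UNIV) h"
    for K and h :: "real \<times> (real^3) \<Rightarrow> real^3"
    by (rule set_integrable_lebesgueI[OF that(3) _ that(2)]) (use that(1) in \<open>simp add: compact_imp_closed\<close>)
  have "(\<lambda>(t, x). scaled_force g t x) locally_integrable_on ({0..} \<times> UNIV)"
    unfolding locally_integrable_on_def using K set_integrable_scaled_force[OF g] by blast
  moreover have "(\<lambda>(t, x). scaled 1 g t x) locally_integrable_on ({0..} \<times> UNIV)"
    unfolding locally_integrable_on_def using K set_integrable_scaled[OF g(2), of 1] by simp
  moreover have "scaled 1 g t locally_integrable_on UNIV" for t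
    by (rule locally_integrable_on_UNIV_I[OF integrable_scaled_slice[OF g(2)]])
  moreover have "\<exists>Q. is_distribution spacetime Q \<and> (\<forall>\<phi>. test_fun spacetime \<phi> \<longrightarrow>
      (LINT (t, x):spacetime|lebesgue. scaled 1 g t x \<bullet> (- dt \<phi> (t, x) - lapl \<phi> (t, x))) - Q (divg \<phi>) =
      (LINT (t, x):spacetime|lebesgue. scaled_force g t x \<bullet> \<phi> (t, x)))"
    by (rule exI[of _ "\<lambda>\<phi>. 0"]) (simp add: is_distribution_zero stokes_momentum[OF g] del: One_nat_def)
  ultimately show ?thesis
    unfolding stokes_solution_def
    using stokes_divergence[OF g div] scaled_initial_limit[OF g(2)] by (simp del: One_nat_def)
qed

section \<open>The counterexample\<close>

text \<open>The rotation field about the third axis, multiplied by the radial cut-off exp(-1 / (1 -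
  |y|^2)) on the unit ball.\<close>

definition profile :: "real^3 \<Rightarrow> real^3" where
  "profile y = flat_exp 0 (1 - y \<bullet> y) *\<^sub>R (y $ 1 *\<^sub>R axis 2 1 - y $ 2 *\<^sub>R axis 1 1)"

lemma alg_inner_self: "alg (\<lambda>y::real^3. y \<bullet> y)"
proof -
  have "y \<bullet> y = (y \<bullet> axis 1 1) * (y \<bullet> axis 1 1) + (y \<bullet> axis 2 1) * (y \<bullet> axis 2 1) +
      (y \<bullet> axis 3 1) * (y \<bullet> axis 3 1)" for y :: "real^3"
    by (simp add: inner_vec_def[of y y] sum_3 inner_axis)
  then show ?thesis by (simp only:) (intro alg.intros)
qed

lemma valg_profile: "valg profile"
proof -
  have eq: "profile = (\<lambda>y. (flat_exp 0 (1 - y \<bullet> y) * (y \<bullet> axis 1 1)) *\<^sub>R axis 2 1 +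
      (flat_exp 0 (1 - y \<bullet> y) * (y \<bullet> axis 2 1)) *\<^sub>R (- axis 1 1))"
    by (simp add: fun_eq_iff profile_def inner_axis scaleR_diff_right)
  show ?thesis
    unfolding eq by (intro valg.intros alg.intros alg_diff alg_inner_self)
qed

lemma smooth_profile: "smooth profile"
  by (rule valg_smooth[OF valg_profile])

lemma bump_profile: "bump profile"
  unfolding bump_def
proof (intro conjI allI impI)
  show "continuous_on UNIV profile" by (rule smooth_continuous_on[OF smooth_profile])
  fix y :: "real^3" assume "1 < norm y"
  then have "1 < norm y ^ 2" by (rule one_less_power) simp
  then show "profile y = 0" by (simp add: profile_def flat_exp_def dot_square_norm)
qed

lemma dir_deriv_profile:
  "dir_deriv h profile y =
    flat_exp 0 (1 - y \<bullet> y) *\<^sub>R (h $ 1 *\<^sub>R axis 2 1 - h $ 2 *\<^sub>R axis 1 1) +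
    (flat_exp 2 (1 - y \<bullet> y) * (- (2 * (y \<bullet> h)))) *\<^sub>R (y $ 1 *\<^sub>R axis 2 1 - y $ 2 *\<^sub>R axis 1 1)"
proof -
  have q: "((\<lambda>y. 1 - y \<bullet> y) has_derivative (\<lambda>h. - (2 * (y \<bullet> h)))) (at y)"
    by (rule derivative_eq_intros refl | simp add: inner_commute)+
  have E: "((\<lambda>y. flat_exp 0 (1 - y \<bullet> y)) has_derivative (\<lambda>h. flat_exp 2 (1 - y \<bullet> y) * (- (2 * (y \<bullet> h))))) (at y)"
    using has_derivative_compose[OF q flat_exp_has_real_derivative[of 0 "1 - y \<bullet> y", unfolded has_field_derivative_def]]
    by (simp add: numeral_2_eq_2)
  have v: "((\<lambda>y::real^3. y $ 1 *\<^sub>R (axis 2 1 :: real^3) - y $ 2 *\<^sub>R axis 1 1) has_derivative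
      (\<lambda>h. h $ 1 *\<^sub>R axis 2 1 - h $ 2 *\<^sub>R axis 1 1)) (at y)"
    by (intro has_derivative_diff has_derivative_scaleR_left bounded_linear_imp_has_derivative bounded_linear_vec_nth)
  show ?thesis
    unfolding profile_def by (rule dir_deriv_eq[OF has_derivative_scaleR[OF E v]])
qed

text \<open>The rotation field has zero divergence, and the gradient of the radial cut-off is
  parallel to y, hence orthogonal to the rotation field.\<close>

lemma divergence_profile: "(\<Sum>i\<in>UNIV. dir_deriv (axis i 1) profile y $ i) = 0"
  unfolding dir_deriv_profile inner_axis by (simp add: sum_3 axis_def)

section \<open>Smooth slices and compact support\<close>

text \<open>Each time slice is the profile after an affine change of variable, so its smoothness
  follows from stability of the generating class under such substitutions.\<close>

lemma alg_affine: "alg f \<Longrightarrow> alg (\<lambda>x. f (a *\<^sub>R (x - v)))"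
proof (induction rule: alg.induct)
  case (inner b)
  have "(a *\<^sub>R (x - v)) \<bullet> b = a * (x \<bullet> b) + - (a * (v \<bullet> b))" for x
    by (simp add: inner_diff_left algebra_simps)
  then show ?case by (simp only:) (intro alg.intros)
qed (auto intro: alg.intros)

lemma valg_affine: "valg f \<Longrightarrow> valg (\<lambda>x. c *\<^sub>R f (a *\<^sub>R (x - v)))"
proof (induction rule: valg.induct)
  case (scale f w)
  have "valg (\<lambda>x. (c * f (a *\<^sub>R (x - v))) *\<^sub>R w)"
    by (intro valg.intros alg.intros alg_affine scale)
  then show ?case by simp
qed (simp add: scaleR_add_right valg.add)

lemma smooth_scaled:
  assumes "valg g"
  shows "smooth (scaled k g t)"
proof (cases "t < 1")
  case True
  then have "scaled k g t = (\<lambda>x. (1 / (1 - t)) ^ k *\<^sub>R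
      g ((1 / (1 - t)) ^ 3 *\<^sub>R (x - sin (1 / (1 - t)) *\<^sub>R axis 1 1)))"
    by (simp add: fun_eq_iff scaled_def profile_coord_def)
  then show ?thesis using valg_smooth[OF valg_affine[OF assms]] by simp
next
  case False
  then have "scaled k g t = (\<lambda>x. 0 *\<^sub>R 0)" by (simp add: fun_eq_iff scaled_def)
  moreover have "valg (\<lambda>x::real^3. 0 *\<^sub>R (0::'a))" by (intro valg.intros alg.const)
  ultimately show ?thesis using valg_smooth by metis
qed

lemma compact_support_scaled:
  assumes "bump g"
  shows "compact (closure {(t, x). 0 \<le> t \<and> scaled k g t x \<noteq> 0})"
proof -
  have "{(t, x). 0 \<le> t \<and> scaled k g t x \<noteq> 0} \<subseteq> {0..1} \<times> cball 0 2"
  proof clarify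
    fix t x assume t: "0 \<le> t" and nz: "scaled k g t x \<noteq> 0"
    let ?c = "sin (1 / (1 - t)) *\<^sub>R axis 1 1 :: real^3"
    have "t < 1" using nz by (auto simp: scaled_def split: if_splits)
    have "dist ?c x \<le> (1 - t) ^ 3" using scaled_zero[OF assms, of x t k] nz by fastforce
    also have "\<dots> \<le> 1" using t \<open>t < 1\<close> by (intro power_le_one) auto
    finally have "norm x \<le> norm ?c + 1"
      using norm_triangle_sub[of x ?c] by (simp add: dist_norm norm_minus_commute)
    moreover have "norm ?c \<le> 1" using abs_sin_le_one[of "1 / (1 - t)"] by simp
    ultimately have "norm x \<le> 2" by linarith
    then show "t \<in> {0..1} \<and> x \<in> cball 0 2" using t \<open>t < 1\<close> by simp
  qed
  moreover have "bounded ({0..1::real} \<times> cball (0::real^3) 2)"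
    by (intro bounded_Times) auto
  ultimately show ?thesis
    unfolding compact_closure by (rule bounded_subset[rotated])
qed

text \<open>The restriction to \<open>ball x r\<close> is dropped: slice integrals of the squared
  gradient are bounded by a constant, and the length r^2 of the time interval alone beats the factor
  1 / r.\<close>

lemma cylinder_energy_tendsto_0:
  fixes h :: "real^3 \<Rightarrow> 'b::euclidean_space"
  assumes h: "bump h" and t: "t > 0"
  shows "((\<lambda>r. ennreal (1 / r) * (\<integral>\<^sup>+(s, y)\<in>parabolic_cylinder r t x. ennreal ((norm (scaled 4 h s y))\<^sup>2) \<partial>lebesgue))
      \<longlongrightarrow> 0) (at_right 0)"
proof -
  let ?q = "\<lambda>y. norm (h y) ^ 2"
  have q: "bump ?q" by (rule bump_norm_power[OF h]) simp
  obtain C where C: "C > 0" "\<And>y. norm (?q y) \<le> C" using bump_bound[OF q] by blast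
  define M where "M = C * unit_ball_vol 3"
  have M: "0 \<le> M" using C by (simp add: M_def)
  have e: "(norm (scaled 4 h s y))\<^sup>2 = scaled 8 ?q s y" for s y
    using norm_scaled_power[of 2 4 h s y] by simp
  note [measurable] = scaled_measurable_bump[OF q]
  have bound: "(\<integral>\<^sup>+(s, y)\<in>parabolic_cylinder r t x. ennreal ((norm (scaled 4 h s y))\<^sup>2) \<partial>lebesgue) \<le> ennreal (M * r\<^sup>2)"
    if r: "0 < r" "r\<^sup>2 < t" for r
  proof -
    let ?Q = "parabolic_cylinder r t x"
    let ?f = "\<lambda>p. ennreal (scaled 8 ?q (fst p) (snd p)) * indicator ?Q p"
    have "open ?Q" unfolding parabolic_cylinder_def by (intro open_Times) auto
    then have [measurable]: "?Q \<in> sets borel" by simp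
    have m: "?f \<in> borel_measurable borel" by measurable
    have "(\<integral>\<^sup>+(s, y)\<in>?Q. ennreal ((norm (scaled 4 h s y))\<^sup>2) \<partial>lebesgue) = (\<integral>\<^sup>+p. ?f p \<partial>lborel)"
      unfolding e case_prod_beta' by (rule nn_integral_completion)
    also have "\<dots> = (\<integral>\<^sup>+s. \<integral>\<^sup>+y. ?f (s, y) \<partial>lborel \<partial>lborel)"
    proof -
      have "?f \<in> borel_measurable (lborel \<Otimes>\<^sub>M lborel)" using m by (simp add: lborel_prod)
      from lborel.nn_integral_fst[OF this] show ?thesis by (simp add: lborel_prod)
    qed
    also have "\<dots> \<le> (\<integral>\<^sup>+s. ennreal M * indicator {t - r\<^sup>2<..<t} s \<partial>lborel)"
    proof (rule nn_integral_mono)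
      fix s
      show "(\<integral>\<^sup>+y. ?f (s, y) \<partial>lborel) \<le> ennreal M * indicator {t - r\<^sup>2<..<t} s"
      proof (cases "s \<in> {t - r\<^sup>2<..<t}")
        case True
        have "(\<integral>\<^sup>+y. ?f (s, y) \<partial>lborel) \<le> (\<integral>\<^sup>+y. ennreal (scaled 8 ?q s y) \<partial>lborel)"
          by (intro nn_integral_mono) (auto simp: indicator_def)
        also have "\<dots> \<le> ennreal M"
          unfolding M_def by (rule nn_integral_scaled_slice_le[OF q]) (use C True r in auto)
        finally show ?thesis using True by simp
      next
        case False
        then have eq: "indicator ?Q (s, y) = (0::ennreal)" for y
          by (auto simp: parabolic_cylinder_def indicator_def)
        show ?thesis unfolding eq by simp
      qed
    qed
    also have "\<dots> = ennreal M * ennreal (r\<^sup>2)"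
      by (subst nn_integral_cmult_indicator) auto
    also have "\<dots> = ennreal (M * r\<^sup>2)" using M by (simp add: ennreal_mult)
    finally show ?thesis .
  qed
  \<comment> \<open>The condition r^2 < t keeps the cylinder within positive times, where the slice
    bound is available.\<close>
  have ev: "\<forall>\<^sub>F r in at_right (0::real). 0 < r \<and> r\<^sup>2 < t"
  proof (rule eventually_conj[OF eventually_at_right_less])
    have "((\<lambda>r::real. r\<^sup>2) \<longlongrightarrow> 0\<^sup>2) (at_right 0)" by (intro tendsto_intros)
    then show "\<forall>\<^sub>F r in at_right 0. r\<^sup>2 < t" using t by (intro order_tendstoD(2)) auto
  qed
  show ?thesis
  proof (rule tendsto_sandwich[of "\<lambda>r. 0"])
    show "\<forall>\<^sub>F r in at_right 0. ennreal (1 / r) *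
        (\<integral>\<^sup>+(s, y)\<in>parabolic_cylinder r t x. ennreal ((norm (scaled 4 h s y))\<^sup>2) \<partial>lebesgue) \<le> ennreal (M * r)"
      using ev
    proof (rule eventually_mono)
      fix r assume r: "0 < r \<and> r\<^sup>2 < t"
      have "ennreal (1 / r) * (\<integral>\<^sup>+(s, y)\<in>parabolic_cylinder r t x. ennreal ((norm (scaled 4 h s y))\<^sup>2) \<partial>lebesgue)
          \<le> ennreal (1 / r) * ennreal (M * r\<^sup>2)"
        using r by (intro mult_left_mono bound) auto
      also have "\<dots> = ennreal (M * r)"
        using r M by (simp add: power2_eq_square flip: ennreal_mult)
      finally show "ennreal (1 / r) *
        (\<integral>\<^sup>+(s, y)\<in>parabolic_cylinder r t x. ennreal ((norm (scaled 4 h s y))\<^sup>2) \<partial>lebesgue) \<le> ennreal (M * r)" .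
    qed
    have "((\<lambda>r. ennreal (M * r)) \<longlongrightarrow> ennreal (M * 0)) (at_right 0)"
      by (intro tendsto_ennrealI tendsto_intros)
    then show "((\<lambda>r. ennreal (M * r)) \<longlongrightarrow> 0) (at_right 0)" by simp
  qed auto
qed

text \<open>Although the field is zero from time 1 on, it is unbounded on every neighbourhood of the
  point: it takes the values \<omega> n times \<open>g y\<close> at earlier points converging to it,
  and continuity there spreads these values over sets of positive measure.\<close>

lemma singular_set_scaled:
  assumes g: "bump g" and y: "g y \<noteq> 0" and a: "\<bar>a\<bar> \<le> 1"
  shows "(1, a *\<^sub>R axis 1 1) \<in> singular_set spacetime (\<lambda>(t, x). scaled 1 g t x)"
proof -
  have False if U: "open U" "(1, a *\<^sub>R axis 1 1) \<in> U"
    and C: "AE q in lebesgue. q \<in> U \<inter> spacetime \<longrightarrow> norm (case q of (t, x) \<Rightarrow> scaled 1 g t x) \<le> C" for U C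
  proof -
    \<comment> \<open>Along the times \<open>1 - 1 / \<omega> n\<close> the moving centre returns to the point \<open>a\<close> of the axis.\<close>
    define \<omega> where "\<omega> n = arcsin a + 2 * real (Suc n) * pi" for n
    \<comment> \<open>The spatial part is the centre plus radius times y, so
      \<open>profile_coord\<close> equals y at every \<open>q n\<close>.\<close>
    define q where "q n = (1 - 1 / \<omega> n, a *\<^sub>R axis 1 1 + (1 / \<omega> n) ^ 3 *\<^sub>R y)" for n
    have as: "- pi / 2 \<le> arcsin a" using a arcsin_lbound[of a] by (simp add: abs_le_iff)
    \<comment> \<open>The shift to \<open>Suc n\<close> compensates for arcsin a, which can be as
      low as - pi / 2, and keeps every \<omega> n positive.\<close>
    have \<omega>_ge: "real (Suc n) \<le> \<omega> n" for n
    proof -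
      have *: "m \<le> arcsin a + 2 * m * pi" if "1 \<le> m" for m
      proof -
        have "1 * m \<le> pi * m" "pi * 1 \<le> pi * m"
          using that pi_ge_two by (intro mult_mono; simp)+
        moreover have "2 * m * pi = pi * m + pi * m" by simp
        ultimately show ?thesis using as pi_gt_zero by linarith
      qed
      show ?thesis unfolding \<omega>_def by (rule *) simp
    qed
    have \<omega>: "0 < \<omega> n" for n 
      by (rule less_le_trans[OF _ \<omega>_ge]) simp
    have \<omega>_top: "filterlim \<omega> at_top sequentially"
      by (rule filterlim_at_top_mono[OF filterlim_compose[OF filterlim_real_sequentially filterlim_Suc]])
        (simp add: \<omega>_ge del: of_nat_Suc)
    have inv: "(\<lambda>n. 1 / \<omega> n) \<longlonglongrightarrow> 0"
      using filterlim_compose[OF tendsto_inverse_0_at_top \<omega>_top] tendsto_inverse_0_at_top[OF \<omega>_top]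
      by (simp add: inverse_eq_divide)
    have q_lim: "q \<longlonglongrightarrow> (1, a *\<^sub>R axis 1 1)"
    proof -
      have "q \<longlonglongrightarrow> (1 - 0, a *\<^sub>R axis 1 1 + 0 ^ 3 *\<^sub>R y)"
        unfolding q_def by (intro tendsto_intros inv)
      then show ?thesis by simp
    qed
    have sn: "sin (\<omega> n) = a" for n
    proof -
      have "sin (\<omega> n) = sin (arcsin a)"
        unfolding \<omega>_def sin_add sin_2npi cos_2npi by simp
      then show ?thesis using a by (simp add: abs_le_iff)
    qed
    have qt: "fst (q n) < 1" for n using \<omega>[of n] by (simp add: q_def)
    have val: "scaled 1 g (fst (q n)) (snd (q n)) = \<omega> n *\<^sub>R g y" for n
      using \<omega>[of n] by (simp add: scaled_def profile_coord_def q_def sn power_one_over)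
    have "open (U \<inter> spacetime)" using U(1) by (intro open_Int open_Times) auto
    moreover have "(1, a *\<^sub>R axis 1 1) \<in> U \<inter> spacetime" using U(2) by simp
    ultimately have "\<forall>\<^sub>F n in sequentially. q n \<in> U \<inter> spacetime"
      using q_lim topological_tendstoD by blast
    moreover have "\<forall>\<^sub>F n in sequentially. C / norm (g y) < \<omega> n"
      using \<omega>_top by (simp add: filterlim_at_top_dense)
    ultimately have "\<forall>\<^sub>F n in sequentially. False"
    proof eventually_elim
      case (elim n)
      have "isCont (\<lambda>p. norm (scaled 1 g (fst p) (snd p))) (q n)"
        using g qt[of n] by (intro continuous_intros scaled_isCont) (auto simp: bump_def)
      then have "norm (scaled 1 g (fst (q n)) (snd (q n))) \<le> C"
        using C \<open>open (U \<inter> spacetime)\<close> elim(1)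
        by (intro AE_open_imp_all[of "U \<inter> spacetime" "\<lambda>p. norm (scaled 1 g (fst p) (snd p))"]) (simp_all add: case_prod_beta')
      then have "\<omega> n * norm (g y) \<le> C" using \<omega>[of n] unfolding val by simp
      then show False using elim(2) y by (simp add: divide_less_eq)
    qed
    then show False by simp
  qed
  then show ?thesis unfolding singular_set_def regular_point_def by auto
qed

text \<open>The first space coordinate does not increase distances, and the singular segment
  projects onto [-1,1] under it.\<close>

lemma hausdorff1_singular_set_scaled:
  assumes "bump g" "g y \<noteq> 0"
  shows "0 < hausdorff1 (singular_set spacetime (\<lambda>(t, x). scaled 1 g t x))"
proof (rule hausdorff1_pos[of "\<lambda>p. snd p $ 1"])
  show "dist (snd p $ 1) (snd q $ 1) \<le> dist p q" for p q :: "real \<times> (real^3)"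
    using dist_vec_nth_le[of "snd p" 1 "snd q"] dist_snd_le[of p q] by simp
  show "{-1..1} \<subseteq> (\<lambda>p. snd p $ 1) ` singular_set spacetime (\<lambda>(t, x). scaled 1 g t x)"
  proof
    fix a :: real assume "a \<in> {-1..1}"
    then have "\<bar>a\<bar> \<le> 1" by (simp add: abs_le_iff)
    from singular_set_scaled[OF assms this]
    show "a \<in> (\<lambda>p. snd p $ 1) ` singular_set spacetime (\<lambda>(t, x). scaled 1 g t x)"
      by (rule rev_image_eqI) simp
  qed
qed

lemma profile_nonzero: "profile ((1 / 2) *\<^sub>R axis 1 1) \<noteq> 0"
proof -
  let ?y = "(1 / 2) *\<^sub>R axis 1 1 :: real^3"
  have "?y \<bullet> ?y = 1 / 4" by (simp add: inner_axis_axis)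
  then have "flat_exp 0 (1 - ?y \<bullet> ?y) > 0" by (simp only: flat_exp_def) simp
  then have "profile ?y $ 2 \<noteq> 0" unfolding profile_def by (simp add: axis_def)
  then show ?thesis by auto
qed

theorem proposition2p3:
  "\<exists>(z0 :: real^3 \<Rightarrow> real^3) (f :: real \<Rightarrow> real^3 \<Rightarrow> real^3) (z :: real \<Rightarrow> real^3 \<Rightarrow> real^3).
     stokes_solution z0 f z \<and>
     (in_Linf_Lp {0<..} 2 UNIV z \<and> in_L2_H1 {0<..} z) \<and>
     compact (closure {(t, x). 0 \<le> t \<and> z t x \<noteq> 0}) \<and>
     (\<forall>t\<ge>0. smooth (z t)) \<and>
     ((\<forall>T>0. in_Linf_Lp {0<..<T} 2 UNIV z \<and> in_L2_H1 {0<..<T} z) \<and>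
      (\<exists>q>6. \<forall>T>0. \<forall>K. compact K \<longrightarrow> in_Linf_Lp {0<..<T} q K z) \<and>
      (\<exists>Dz. has_spatial_gradient {0<..} z Dz \<and>
         (\<forall>t>0. \<forall>x.
            ((\<lambda>r. ennreal (1 / r) *
                (\<integral>\<^sup>+(s, y)\<in>parabolic_cylinder r t x. ennreal ((norm (Dz s y))\<^sup>2) \<partial>lebesgue))
              \<longlongrightarrow> 0) (at_right 0)))) \<and>
     hausdorff1 (singular_set ({0<..} \<times> UNIV) (\<lambda>(t, x). z t x)) > 0"
proof (intro exI conjI allI impI)
  note g = smooth_profile bump_profile
  let ?z = "scaled 1 profile"
  have L: "in_Linf_Lp I (real n) S ?z" if "0 < n" "n \<le> 9" "I \<subseteq> {0<..}" "S \<in> sets lebesgue" for I n S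
    by (rule in_Linf_Lp_scaled[OF g(2)]) (use that in simp_all)
  have L2: "in_Linf_Lp I 2 UNIV ?z" if "I \<subseteq> {0<..}" for I
    using L[of 2 I UNIV] that by simp
  show "stokes_solution (?z 0) (scaled_force profile) ?z"
    by (rule stokes_solution_scaled[OF g divergence_profile])
  show "in_Linf_Lp {0<..} 2 UNIV ?z" by (rule L2) simp
  show "in_L2_H1 {0<..} ?z" by (rule in_L2_H1_scaled[OF g]) simp_all
  show "compact (closure {(t, x). 0 \<le> t \<and> ?z t x \<noteq> 0})" by (rule compact_support_scaled[OF g(2)])
  show "smooth (?z t)" for t by (rule smooth_scaled[OF valg_profile])
  show "in_Linf_Lp {0<..<T} 2 UNIV ?z" for T by (rule L2) auto
  show "in_L2_H1 {0<..<T} ?z" for T by (rule in_L2_H1_scaled[OF g]) auto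
  \<comment> \<open>The exponent 7 is the least natural number above 6, and 1 * 7 <= 9 places it in
    the range of \<open>in_Linf_Lp_scaled\<close>.\<close>
  show "(6::real) < 7" by simp
  show "in_Linf_Lp {0<..<T} 7 K ?z" if "compact K" for T and K
    using L[of 7 "{0<..<T}" K] that by (simp add: compact_imp_closed subset_iff)
  show "has_spatial_gradient {0<..} ?z (scaled 4 (jacobian profile))"
    using spatial_gradient_scaled[OF g, of "{0<..}" 1] by simp
  show "((\<lambda>r. ennreal (1 / r) *
      (\<integral>\<^sup>+(s, y)\<in>parabolic_cylinder r t x. ennreal ((norm (scaled 4 (jacobian profile) s y))\<^sup>2) \<partial>lebesgue))
      \<longlongrightarrow> 0) (at_right 0)" if "t > 0" for t x
    by (rule cylinder_energy_tendsto_0[OF bump_jacobian[OF g] that])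
  show "0 < hausdorff1 (singular_set ({0<..} \<times> UNIV) (\<lambda>(t, x). ?z t x))"
    by (rule hausdorff1_singular_set_scaled[OF g(2) profile_nonzero])
qed

end
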